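(* Let $\mathcal{S}=(A,B,C,\mathcal{N},\mathcal{M})$ be a BQO system of order $n$ and $\widehat{\mathcal{S}}=(\widehat A,\widehat B,\widehat C,\widehat{\mathcal{N}},\widehat{\mathcal{M}})$ a BQO system of order $r$, both with $m$ inputs and $p$ outputs, with $A,\widehat A$ stable and initial states $x(0)=0$, $\widehat x(0)=0$. Suppose that the equations $$AP+PA^T+\sum_{k=1}^mN_kPN_k^T+BB^T=0,\qquad \widehat A\widehat P+\widehat P\widehat A^T+\sum_{k=1}^m\widehat N_k\widehat P\widehat N_k^T+\widehat B\widehat B^T=0,$$ $$AX+X\widehat A^T+\sum_{k=1}^mN_kX\widehat N_k^T+B\widehat B^T=0$$ have unique solutions $P\in\mathbb{R}^{n\times n}$, $\widehat P\in\mathbb{R}^{r\times r}$, $X\in\mathbb{R}^{n\times r}$, with $P$ and $\widehat P$ symmetric positive semidefinite. Then for every input $u\in L^2([0,\infty),\mathbb{R}^m)$ applied to both systems, the output error satisfies $$\sup_{t\ge0}\|y(t)-\widehat y(t)\|_2^2\le\|\mathcal{S}-\widehat{\mathcal{S}}\|_{\mathcal{H}_2}^2\left(e^{\|u^0\|_{L^2}^2}\|u\|_{L^2}^2+e^{2\|u^0\|_{L^2}^2}\|u\otimes u\|_{L^2}^2\right).$$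
   Context: A BQO (bilinear quadratic output) system $\mathcal{S}=(A,B,C,\mathcal{N},\mathcal{M})$ of order $n$ with $m$ inputs and $p$ outputs is $$\dot x(t)=Ax(t)+\sum_{k=1}^mN_kx(t)u_k(t)+Bu(t),\quad x(0)=0,\qquad y(t)=Cx(t)+[x(t)^TM_1x(t),\dots,x(t)^TM_px(t)]^T,\quad t\in[0,\infty),$$ with $A,N_k\in\mathbb{R}^{n\times n}$, $B\in\mathbb{R}^{n\times m}$, $C\in\mathbb{R}^{p\times n}$, symmetric $M_j\in\mathbb{R}^{n\times n}$, $\mathcal{N}=[N_1\,\dots\,N_m]$, $\mathcal{M}=[M_1\,\dots\,M_p]$. Hatted quantities denote the analogous objects of $\widehat{\mathcal{S}}$ (state $\widehat x(t)\in\mathbb{R}^r$, output $\widehat y(t)$). Stable means all eigenvalues have negative real part. Set $\mathfrak{M}=[\operatorname{vec}(M_1)\,\dots\,\operatorname{vec}(M_p)]^T$. $\mathcal{H}_2$ norm of a BQO system: let $\bar P_1(t_1)=e^{At_1}B$ and $\bar P_i(t_1,\dots,t_i)=e^{At_i}\mathcal{N}(I_m\otimes\bar P_{i-1}(t_1,\dots,t_{i-1}))$ for $i\ge2$; $h_{C,i}=C\bar P_i(t_1,\dots,t_i)$, $h_{M,i,j}=\mathfrak{M}(\bar P_i(t_1,\dots,t_i)\otimes\bar P_j(\bar t_1,\dots,\bar t_j))$. Then $$\|\mathcal{S}\|_{\mathcal{H}_2}^2=\sum_{i=1}^\infty\int_0^\infty\!\!\cdots\!\int_0^\infty\|h_{C,i}\|_F^2\,dt_1\cdots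 dt_i+\sum_{i,j=1}^\infty\int_0^\infty\!\!\cdots\!\int_0^\infty\|h_{M,i,j}\|_F^2\,dt_1\cdots dt_i\,d\bar t_1\cdots d\bar t_j.$$ Error system: $\mathcal{S}-\widehat{\mathcal{S}}$ denotes the BQO system of order $n+r$ with matrices $A_e=\operatorname{diag}(A,\widehat A)$, $N_{e,k}=\operatorname{diag}(N_k,\widehat N_k)$, $B_e=\begin{bmatrix}B\\\widehat B\end{bmatrix}$, $C_e=[C\ \ -\widehat C]$, $M_{e,j}=\operatorname{diag}(M_j,-\widehat M_j)$, whose output is $y-\widehat y$. Input norms: $\|u\|_{L^2}^2=\int_0^\infty\|u(s)\|_2^2\,ds$; $u^0=[u_1^0,\dots,u_m^0]^T$ with $u^0_k=0$ if $N_{e,k}=0$ (i.e. $N_k=0$ and $\widehat N_k=0$) and $u^0_k=u_k$ otherwise; $\|u\otimes u\|_{L^2}^2=\int_0^\infty\int_0^\infty\|u(s_1)\otimes u(s_2)\|_2^2\,ds_1\,ds_2$. *)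

theory Defs
  imports "HOL-Analysis.Analysis"
begin

text \<open>
  The state dimension, the number of inputs and the number of outputs are the cardinalities of the
  finite index types \<open>'n\<close>, \<open>'m\<close> and \<open>'p\<close>; the blocks of
  \<open>\<N> = [N\<^sub>1 \<dots> N\<^sub>m]\<close> and \<open>\<M> = [M\<^sub>1 \<dots> M\<^sub>p]\<close> are kept as families of matrices.
\<close>

record ('n, 'm, 'p) bqo =
  sysA :: "real ^ 'n::finite ^ 'n::finite"
  sysB :: "real ^ 'm::finite ^ 'n::finite"
  sysC :: "real ^ 'n::finite ^ 'p::finite"
  sysN :: "'m::finite \<Rightarrow> real ^ 'n::finite ^ 'n::finite"
  sysM :: "'p::finite \<Rightarrow> real ^ 'n::finite ^ 'n::finite"

definition symmetric_matrix :: "real ^ 'n ^ 'n \<Rightarrow> bool" where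
  "symmetric_matrix Q \<longleftrightarrow> transpose Q = Q"

definition sym_pos_semidef :: "real ^ 'n ^ 'n \<Rightarrow> bool" where
  "sym_pos_semidef Q \<longleftrightarrow> symmetric_matrix Q \<and> (\<forall>v. 0 \<le> v \<bullet> (Q *v v))"

definition bqo_system :: "('n::finite, 'm::finite, 'p::finite) bqo \<Rightarrow> bool" where
  "bqo_system S \<longleftrightarrow> (\<forall>j. symmetric_matrix (sysM S j))"

definition complex_eigenvalue :: "real ^ 'n ^ 'n \<Rightarrow> complex \<Rightarrow> bool" where
  "complex_eigenvalue Q z \<longleftrightarrow> (\<exists>v. v \<noteq> 0 \<and> map_matrix complex_of_real Q *v v = z *s v)"

definition stable_matrix :: "real ^ 'n ^ 'n \<Rightarrow> bool" where
  "stable_matrix Q \<longleftrightarrow> (\<forall>z. complex_eigenvalue Q z \<longrightarrow> Re z < 0)"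


subsection \<open>Trajectories\<close>

definition bqo_rhs ::
  "('n::finite, 'm::finite, 'p::finite) bqo \<Rightarrow> real ^ 'm \<Rightarrow> real ^ 'n \<Rightarrow> real ^ 'n" where
  "bqo_rhs S w z = sysA S *v z + (\<Sum>k\<in>UNIV. (w $ k) *\<^sub>R (sysN S k *v z)) + sysB S *v w"

text \<open>
  Inputs are only square integrable, so the differential equation is understood in the sense of
  Caratheodory: \<open>x\<close> is locally absolutely continuous and satisfies the equation almost everywhere,
  that is, it satisfies the integrated equation.
\<close>

definition bqo_trajectory ::
  "('n::finite, 'm::finite, 'p::finite) bqo \<Rightarrow> (real \<Rightarrow> real ^ 'm) \<Rightarrow> (real \<Rightarrow> real ^ 'n) \<Rightarrow> bool" where
  "bqo_trajectory S u x \<longleftrightarrow> x 0 = 0 \<and>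
     (\<forall>t\<ge>0. (\<lambda>s. bqo_rhs S (u s) (x s)) absolutely_integrable_on {0..t} \<and>
            x t = integral {0..t} (\<lambda>s. bqo_rhs S (u s) (x s)))"

definition bqo_output ::
  "('n::finite, 'm::finite, 'p::finite) bqo \<Rightarrow> (real \<Rightarrow> real ^ 'n) \<Rightarrow> real \<Rightarrow> real ^ 'p" where
  "bqo_output S x t = sysC S *v x t + (\<chi> j. x t \<bullet> (sysM S j *v x t))"


subsection \<open>Volterra kernels and the \<open>H\<^sub>2\<close> norm\<close>

definition matrix_exp :: "real ^ 'n ^ 'n \<Rightarrow> real ^ 'n ^ 'n" where
  "matrix_exp Q = (\<Sum>k. (1 / fact k) *\<^sub>R (((**) Q ^^ k) (mat 1)))"

definition kron_vec :: "real ^ 'a \<Rightarrow> real ^ 'b \<Rightarrow> real ^ ('a \<times> 'b)" (infixr "\<otimes>\<^sub>v" 75) where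
  "v \<otimes>\<^sub>v w = (\<chi> ab. v $ fst ab * w $ snd ab)"

text \<open>The columns are stacked: the first index is the column index of the matrix.\<close>

definition vec_of :: "real ^ 'n ^ 'n \<Rightarrow> real ^ ('n \<times> 'n)" where
  "vec_of Q = (\<chi> ab. Q $ snd ab $ fst ab)"

definition N_block :: "('n::finite, 'm::finite, 'p::finite) bqo \<Rightarrow> real ^ ('m \<times> 'n) ^ 'n" where
  "N_block S = (\<chi> a kb. sysN S (fst kb) $ a $ snd kb)"

definition M_vec :: "('n::finite, 'm::finite, 'p::finite) bqo \<Rightarrow> real ^ ('n \<times> 'n) ^ 'p" where
  "M_vec S = (\<chi> j. vec_of (sysM S j))"

text \<open>
  The matrix \<open>P\<^sub>i(t\<^sub>1, \<dots>, t\<^sub>i)\<close> has \<open>m\<^sup>i\<close> columns, a number that depends on \<open>i\<close>. They are indexed by the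
  lists \<open>[k\<^sub>i, \<dots>, k\<^sub>1]\<close> over \<open>'m\<close> of length \<open>i\<close>, which refines the Kronecker indexing: column
  \<open>(k, ks)\<close> of \<open>I\<^sub>m \<otimes> P\<close> is the Kronecker product of the \<open>k\<close>-th unit vector with column \<open>ks\<close> of \<open>P\<close>.
  So \<open>Pbar S t ks\<close> is the column \<open>ks\<close> of \<open>P\<^sub>i(t 1, \<dots>, t i)\<close> where \<open>i\<close> is the length of \<open>ks\<close>; there is
  no \<open>P\<^sub>0\<close>, and the value at the empty list is never used.
\<close>

fun Pbar ::
  "('n::finite, 'm::finite, 'p::finite) bqo \<Rightarrow> (nat \<Rightarrow> real) \<Rightarrow> 'm list \<Rightarrow> real ^ 'n" where
  "Pbar S t [] = 0"
| "Pbar S t [k] = matrix_exp (t 1 *\<^sub>R sysA S) *v column k (sysB S)"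
| "Pbar S t (k # l # ks) = matrix_exp (t (length (k # l # ks)) *\<^sub>R sysA S) *v
     (N_block S *v (axis k 1 \<otimes>\<^sub>v Pbar S t (l # ks)))"

definition h_C ::
  "('n::finite, 'm::finite, 'p::finite) bqo \<Rightarrow> (nat \<Rightarrow> real) \<Rightarrow> 'm list \<Rightarrow> real ^ 'p" where
  "h_C S t ks = sysC S *v Pbar S t ks"

definition h_M ::
  "('n::finite, 'm::finite, 'p::finite) bqo \<Rightarrow> (nat \<Rightarrow> real) \<Rightarrow> (nat \<Rightarrow> real) \<Rightarrow>
     'm list \<times> 'm list \<Rightarrow> real ^ 'p" where
  "h_M S t t' kl = M_vec S *v (Pbar S t (fst kl) \<otimes>\<^sub>v Pbar S t' (snd kl))"

definition col_indices :: "nat \<Rightarrow> 'm list set" where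
  "col_indices i = {ks. length ks = i}"

definition frobenius_sq :: "'c set \<Rightarrow> ('c \<Rightarrow> real ^ 'p) \<Rightarrow> real" where
  "frobenius_sq J H = (\<Sum>c\<in>J. \<Sum>a\<in>UNIV. (H c $ a)\<^sup>2)"

definition nonneg_orthant :: "nat \<Rightarrow> (nat \<Rightarrow> real) set" where
  "nonneg_orthant i = ({1..i} \<rightarrow>\<^sub>E {0..})"

text \<open>
  The integrands are nonnegative, so integrals and sums are taken in the extended nonnegative reals;
  the norm is finite iff this value is. The series start at index 1, hence the \<open>Suc\<close>.
\<close>

definition H2_norm_sq :: "('n::finite, 'm::finite, 'p::finite) bqo \<Rightarrow> ennreal" where
  "H2_norm_sq S =
     (\<Sum>i. \<integral>\<^sup>+ t \<in> nonneg_orthant (Suc i).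
        ennreal (frobenius_sq (col_indices (Suc i)) (h_C S t))
        \<partial>Pi\<^sub>M {1..Suc i} (\<lambda>_. lborel)) +
     (\<Sum>i. \<Sum>j. \<integral>\<^sup>+ t \<in> nonneg_orthant (Suc i). (\<integral>\<^sup>+ t' \<in> nonneg_orthant (Suc j).
        ennreal (frobenius_sq (col_indices (Suc i) \<times> col_indices (Suc j)) (h_M S t t'))
        \<partial>Pi\<^sub>M {1..Suc j} (\<lambda>_. lborel)) \<partial>Pi\<^sub>M {1..Suc i} (\<lambda>_. lborel))"


subsection \<open>The error system\<close>

definition block_diag :: "real ^ 'n ^ 'n \<Rightarrow> real ^ 'r ^ 'r \<Rightarrow> real ^ ('n + 'r) ^ ('n + 'r)" where
  "block_diag Q R = (\<chi> i j. case (i, j) of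
       (Inl a, Inl b) \<Rightarrow> Q $ a $ b
     | (Inr a, Inr b) \<Rightarrow> R $ a $ b
     | _ \<Rightarrow> 0)"

definition stack_rows :: "real ^ 'm ^ 'n \<Rightarrow> real ^ 'm ^ 'r \<Rightarrow> real ^ 'm ^ ('n + 'r)" where
  "stack_rows Q R = (\<chi> i. case i of Inl a \<Rightarrow> Q $ a | Inr a \<Rightarrow> R $ a)"

definition append_cols :: "real ^ 'n ^ 'p \<Rightarrow> real ^ 'r ^ 'p \<Rightarrow> real ^ ('n + 'r) ^ 'p" where
  "append_cols Q R = (\<chi> i j. case j of Inl a \<Rightarrow> Q $ i $ a | Inr a \<Rightarrow> R $ i $ a)"

definition error_system ::
  "('n::finite, 'm::finite, 'p::finite) bqo \<Rightarrow> ('r::finite, 'm, 'p) bqo \<Rightarrow> ('n + 'r, 'm, 'p) bqo" where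
  "error_system S S' =
     \<lparr> sysA = block_diag (sysA S) (sysA S'),
       sysB = stack_rows (sysB S) (sysB S'),
       sysC = append_cols (sysC S) (- sysC S'),
       sysN = (\<lambda>k. block_diag (sysN S k) (sysN S' k)),
       sysM = (\<lambda>j. block_diag (sysM S j) (- sysM S' j)) \<rparr>"

text \<open>
  For \<open>S' = S\<close> this is the generalized Lyapunov equation
  \<open>A P + P A\<^sup>T + (\<Sum>k. N\<^sub>k P N\<^sub>k\<^sup>T) + B B\<^sup>T = 0\<close>.
\<close>

definition gen_sylvester ::
  "('n::finite, 'm::finite, 'p::finite) bqo \<Rightarrow> ('r::finite, 'm, 'p) bqo \<Rightarrow> real ^ 'r ^ 'n \<Rightarrow> bool" where
  "gen_sylvester S S' X \<longleftrightarrow>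
     sysA S ** X + X ** transpose (sysA S')
     + (\<Sum>k\<in>UNIV. sysN S k ** X ** transpose (sysN S' k))
     + sysB S ** transpose (sysB S') = 0"


subsection \<open>Input norms\<close>

definition L2_input :: "(real \<Rightarrow> real ^ 'm) \<Rightarrow> bool" where
  "L2_input u \<longleftrightarrow> u \<in> borel_measurable (lebesgue_on {0..}) \<and>
     integrable (lebesgue_on {0..}) (\<lambda>s. (norm (u s))\<^sup>2)"

definition L2_norm_sq :: "(real \<Rightarrow> real ^ 'm) \<Rightarrow> real" where
  "L2_norm_sq u = (\<integral>s. (norm (u s))\<^sup>2 \<partial>lebesgue_on {0..})"

definition L2_norm_sq_kron :: "(real \<Rightarrow> real ^ 'm) \<Rightarrow> real" where
  "L2_norm_sq_kron u =
     (\<integral>s1. (\<integral>s2. (norm (u s1 \<otimes>\<^sub>v u s2))\<^sup>2 \<partial>lebesgue_on {0..}) \<partial>lebesgue_on {0..})"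

text \<open>The input \<open>u\<^sup>0\<close>, taken with respect to the matrices \<open>N\<^sub>k\<close> of \<open>E\<close>.\<close>

definition input0 ::
  "('n::finite, 'm::finite, 'p::finite) bqo \<Rightarrow> (real \<Rightarrow> real ^ 'm) \<Rightarrow> real \<Rightarrow> real ^ 'm" where
  "input0 E u s = (\<chi> k. if sysN E k = 0 then 0 else u s $ k)"

end

theory Submission
  imports Defs
begin

text \<open>
For a vector \<open>w\<close> let \<open>\<E>(w)\<close> (\<open>total_energy\<close>) be the sum over \<open>i\<close> of the squared \<open>L\<^sup>2\<close> norms of
\<open>w\<^sup>T P\<^sub>i\<close>, where \<open>P\<^sub>i\<close> are the Volterra kernels. As a function of \<open>w\<close> it is the quadratic form of the
controllability Gramian.

Moving the outermost exponential of \<open>P\<^sub>i\<close> onto \<open>w\<close>, that is, writing \<open>\<psi>(\<tau>) = exp (\<tau> A)\<^sup>T w\<close>, gives the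
equation
\<open>\<E>(w) = \<integral>\<^sub>0\<^sup>\<infinity> |B\<^sup>T \<psi>(\<tau>)|\<^sup>2 + \<Sum>\<^sub>k \<E>(N\<^sub>k\<^sup>T \<psi>(\<tau>)) d\<tau>\<close> (\<open>total_energy_eq\<close>).
A trajectory satisfies a formula of the same shape (\<open>variation_of_constants\<close>),
\<open>w \<bullet> x(t) = \<integral>\<^sub>0\<^sup>t B\<^sup>T \<psi>(t - s) \<bullet> u(s) + \<Sum>\<^sub>k u\<^sup>0\<^sub>k(s) (N\<^sub>k\<^sup>T \<psi>(t - s) \<bullet> x(s)) ds\<close>.
If \<open>(v \<bullet> x(s))\<^sup>2 \<le> c(s) \<E>(v)\<close> holds for all \<open>v\<close> at the times \<open>s\<close> before \<open>t\<close>, the Cauchy-Schwarz inequality in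
time and in \<open>k\<close> together bounds \<open>(w \<bullet> x(t))\<^sup>2\<close> by \<open>\<E>(w)\<close> times \<open>\<integral>\<^sub>0\<^sup>t |u|\<^sup>2 + |u\<^sup>0|\<^sup>2 c\<close>, and this
factor is at most \<open>c(t)\<close> for \<open>c(t) = U exp (\<integral>\<^sub>0\<^sup>t |u\<^sup>0|\<^sup>2)\<close>, where \<open>U\<close> is the squared \<open>L\<^sup>2\<close> norm of \<open>u\<close>.
Started from a crude bound, the argument halves the error term at each repetition, so that
\<open>(w \<bullet> x(t))\<^sup>2 \<le> c(t) \<E>(w)\<close> (\<open>trajectory_le_energy\<close>): the exponential in the theorem comes from here.

The linear output follows with the rows of \<open>C\<close> in the place of \<open>w\<close>. For the quadratic output the
bound is used twice: \<open>(x \<bullet> M x)\<^sup>2 \<le> c \<E>(M x)\<close>, the form \<open>\<E>(M x)\<close> is a sum of integrals of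
\<open>(M x \<bullet> P\<^sub>i)\<^sup>2 = (M P\<^sub>i \<bullet> x)\<^sup>2 \<le> c \<E>(M P\<^sub>i)\<close>, and the integrals of \<open>\<E>(M P\<^sub>i)\<close> are the quadratic part of
the \<open>H\<^sub>2\<close> norm (\<open>quadratic_output_le\<close>). This explains the factors \<open>c\<close> and \<open>c\<^sup>2\<close>, which are
the two summands of the bound since the squared \<open>L\<^sup>2\<close> norm of \<open>u \<otimes> u\<close> is \<open>U\<^sup>2\<close>; one more
Cauchy-Schwarz inequality adds the two outputs.

It remains to see that \<open>\<E>\<close> is finite. If \<open>P\<close> is positive semidefinite and satisfies the generalized
Lyapunov equation, or the inequality with \<open>\<le> 0\<close>, then \<open>\<psi> \<bullet> P \<psi>\<close> decreases along \<open>\<psi>\<close> at least at the rate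
\<open>|B\<^sup>T \<psi>|\<^sup>2 + \<Sum>\<^sub>k N\<^sub>k\<^sup>T \<psi> \<bullet> P N\<^sub>k\<^sup>T \<psi>\<close>, and induction on the number of kernels yields
\<open>\<E>(w) \<le> w \<bullet> P w\<close> (\<open>total_energy_le\<close>). For the error system the block diagonal matrix with blocks
\<open>2 P\<close> and \<open>2 P'\<close> satisfies the inequality.
\<close>

section \<open>Increments of absolutely continuous functions\<close>

text \<open>
On a partition so fine that \<open>\<phi>\<close> grows by at most \<open>e\<close> on each piece, the increments of \<open>F\<close> add up to at
most \<open>e (\<phi> b - \<phi> a)\<close>. The primitives below are only absolutely continuous; their chain and product
rules hold on short intervals up to products of increments, and such errors vanish in the limit of
fine partitions.
\<close>

lemma nonincreasing_if_increments_quadratic: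
  fixes F \<phi> :: "real \<Rightarrow> real"
  assumes ab: "a \<le> b" and cont: "continuous_on {a..b} \<phi>"
    and mono: "\<And>s t. a \<le> s \<Longrightarrow> s \<le> t \<Longrightarrow> t \<le> b \<Longrightarrow> \<phi> s \<le> \<phi> t"
    and incr: "\<And>s t. a \<le> s \<Longrightarrow> s \<le> t \<Longrightarrow> t \<le> b \<Longrightarrow> F t - F s \<le> (\<phi> t - \<phi> s)\<^sup>2"
  shows "F b \<le> F a"
proof -
  have eps: "a \<le> a \<and> b \<le> b \<longrightarrow> F b - F a \<le> e * (\<phi> b - \<phi> a)" if e: "e > 0" for e
  proof (rule Bolzano[OF ab, where P = "\<lambda>s t. a \<le> s \<and> t \<le> b \<longrightarrow> F t - F s \<le> e * (\<phi> t - \<phi> s)"], goal_cases)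
    case (1 p q r)
    then show ?case by (auto simp: algebra_simps)
  next
    case local: (2 x)
    from cont local that obtain d where d: "d > 0"
      and dd: "\<And>y. y \<in> {a..b} \<Longrightarrow> dist y x < d \<Longrightarrow> dist (\<phi> y) (\<phi> x) < e / 2"
      unfolding continuous_on_iff by (metis atLeastAtMost_iff half_gt_zero)
    show ?case
    proof (intro exI[of _ d] conjI[OF d] allI impI)
      fix s t assume st: "s \<le> x \<and> x \<le> t \<and> t - s < d" and *: "a \<le> s \<and> t \<le> b"
      have "dist (\<phi> s) (\<phi> x) < e/2" "dist (\<phi> t) (\<phi> x) < e/2"
        by (rule dd; use st * local in \<open>auto simp: dist_real_def\<close>)+
      then have le: "\<phi> t - \<phi> s \<le> e" unfolding dist_real_def by linarith
      have "F t - F s \<le> (\<phi> t - \<phi> s)\<^sup>2" using incr st * by auto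
      also have "\<dots> \<le> e * (\<phi> t - \<phi> s)"
        unfolding power2_eq_square using le mono[of s t] st * by (intro mult_right_mono) auto
      finally show "F t - F s \<le> e * (\<phi> t - \<phi> s)" .
    qed
  qed
  show ?thesis
  proof (rule ccontr)
    assume "\<not> ?thesis"
    then have pos: "F b - F a > 0" by simp
    define D where "D = \<phi> b - \<phi> a"
    have D: "D \<ge> 0" using mono[of a b] ab by (simp add: D_def)
    have "F b - F a \<le> ((F b - F a) / (2 * (D + 1))) * D"
      unfolding D_def using eps[of "(F b - F a) / (2 * (D + 1))"] pos D by (simp add: D_def)
    also have "\<dots> < F b - F a" using pos mult_nonneg_nonneg[OF D less_imp_le[OF pos]] D by (simp add: field_simps add_pos_nonneg)
    finally show False by simp
  qed
qed

lemma continuous_times_absolutely_integrable: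
  fixes f :: "real \<Rightarrow> 'a::euclidean_space"
  assumes "f absolutely_integrable_on {a..b}" "continuous_on {a..b} g"
  shows "(\<lambda>s. f s \<bullet> g s) absolutely_integrable_on {a..b}"
proof -
  have "(\<lambda>s. g s \<bullet> f s) absolutely_integrable_on {a..b}"
  proof (rule absolutely_integrable_bounded_measurable_product[where h = "(\<bullet>)"])
    show "bilinear ((\<bullet>) :: 'a \<Rightarrow> 'a \<Rightarrow> real)"
      by (simp add: bilinear_conv_bounded_bilinear bounded_bilinear_inner)
    show "g \<in> borel_measurable (lebesgue_on {a..b})"
      by (rule continuous_imp_measurable_on_sets_lebesgue) (use assms in auto)
    show "bounded (g ` {a..b})"
      by (intro compact_imp_bounded compact_continuous_image assms) auto
  qed (use assms in auto)
  then show ?thesis by (simp add: inner_commute)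
qed

text \<open>
The chain rule for \<open>exp (F t)\<close>, one inequality of it. Since \<open>F\<close> is nondecreasing and \<open>1 + z \<le> exp z\<close>, the
increments of the two sides compare up to the product of the increments of \<open>F\<close> and of \<open>exp \<circ> F\<close>.
\<close>

lemma integral_times_exp_primitive_le:
  fixes f :: "real \<Rightarrow> real"
  assumes T: "0 \<le> T" and f: "f absolutely_integrable_on {0..T}"
    and nonneg: "\<And>s. s \<in> {0..T} \<Longrightarrow> 0 \<le> f s"
  defines "F \<equiv> \<lambda>t. integral {0..t} f"
  shows "(\<lambda>s. f s * exp (F s)) absolutely_integrable_on {0..T}" (is ?int)
    and "integral {0..T} (\<lambda>s. f s * exp (F s)) \<le> exp (F T) - 1"
proof -
  have fi: "f integrable_on {0..T}"
    using f by (simp add: absolutely_integrable_on_def)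
  have contF: "continuous_on {0..T} F"
    unfolding F_def by (rule indefinite_integral_continuous_1[OF fi])
  have incF: "F t - F s = integral {s..t} f" if "0 \<le> s" "s \<le> t" "t \<le> T" for s t
    unfolding F_def using that Henstock_Kurzweil_Integration.integral_combine[of 0 s t f] fi
    by (simp add: integrable_on_subinterval)
  have monoF: "F s \<le> F t" if "0 \<le> s" "s \<le> t" "t \<le> T" for s t
  proof -
    have "0 \<le> integral {s..t} f"
      by (intro Henstock_Kurzweil_Integration.integral_nonneg integrable_on_subinterval[OF fi])
        (use that nonneg in auto)
    then show ?thesis using incF[OF that] by simp
  qed
  have "(\<lambda>s. f s \<bullet> exp (F s)) absolutely_integrable_on {0..T}"
    by (intro continuous_times_absolutely_integrable f continuous_on_exp contF)
  then show int: ?int by simp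
  then have gi: "(\<lambda>s. f s * exp (F s)) integrable_on {0..T}"
    by (simp add: absolutely_integrable_on_def)
  define G where "G t = integral {0..t} (\<lambda>s. f s * exp (F s))" for t
  have "G T - exp (F T) \<le> G 0 - exp (F 0)"
  proof (rule nonincreasing_if_increments_quadratic[where \<phi> = "\<lambda>t. exp (F t) + F t" and F = "\<lambda>t. G t - exp (F t)"])
    show "continuous_on {0..T} (\<lambda>t. exp (F t) + F t)"
      by (intro continuous_intros contF)
    fix s t assume st: "0 \<le> s" "s \<le> t" "t \<le> T"
    show "exp (F s) + F s \<le> exp (F t) + F t"
      using monoF[OF st] by (simp add: add_mono)
    have "G t - G s = integral {s..t} (\<lambda>r. f r * exp (F r))"
      unfolding G_def using st gi
        Henstock_Kurzweil_Integration.integral_combine[of 0 s t "\<lambda>r. f r * exp (F r)"]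
      by (simp add: integrable_on_subinterval)
    also have "\<dots> \<le> integral {s..t} (\<lambda>r. f r * exp (F t))"
    proof (rule integral_le)
      show "(\<lambda>r. f r * exp (F r)) integrable_on {s..t}"
        by (rule integrable_on_subinterval[OF gi]) (use st in auto)
      show "(\<lambda>r. f r * exp (F t)) integrable_on {s..t}"
        by (intro integrable_on_mult_left integrable_on_subinterval[OF fi]) (use st in auto)
    qed (use st nonneg monoF in \<open>auto intro!: mult_left_mono\<close>)
    also have "\<dots> = (F t - F s) * exp (F t)"
      using incF[OF st] by simp
    finally have 1: "G t - G s \<le> (F t - F s) * exp (F t)" .
    have "1 + (F t - F s) \<le> exp (F t - F s)" by (rule exp_ge_add_one_self)
    then have "exp (F s) * (1 + (F t - F s)) \<le> exp (F s) * exp (F t - F s)"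
      by (intro mult_left_mono) auto
    also have "\<dots> = exp (F t)" by (simp flip: exp_add)
    finally have 2: "exp (F s) * (F t - F s) \<le> exp (F t) - exp (F s)"
      by (simp add: algebra_simps)
    define p where "p = F t - F s"
    define q where "q = exp (F t) - exp (F s)"
    have pq: "p \<ge> 0" "q \<ge> 0" using monoF[OF st] by (auto simp: p_def q_def)
    have "(G t - exp (F t)) - (G s - exp (F s)) \<le> p * q"
      using 1 2 unfolding p_def q_def by (simp add: algebra_simps)
    also have "\<dots> \<le> (q + p)\<^sup>2"
      using pq by (simp add: power2_sum)
    finally show "(G t - exp (F t)) - (G s - exp (F s)) \<le> (exp (F t) + F t - (exp (F s) + F s))\<^sup>2"
      by (simp add: p_def q_def algebra_simps)
  qed (use T in auto)
  then show "integral {0..T} (\<lambda>s. f s * exp (F s)) \<le> exp (F T) - 1"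
    by (simp add: G_def F_def)
qed

text \<open>
The product rule for the primitive \<open>x\<close> of an integrable function and a \<open>C\<^sup>1\<close> function. On \<open>[s, t]\<close> it
fails by at most \<open>2 K (t - s) (V t - V s)\<close>, where \<open>K\<close> bounds \<open>\<psi>'\<close> and \<open>V\<close> is the primitive of
\<open>norm v\<close>.
\<close>

lemma integral_by_parts_absolutely_continuous:
  fixes v \<psi> \<psi>' :: "real \<Rightarrow> 'a::euclidean_space"
  assumes T: "0 \<le> T" and v: "v absolutely_integrable_on {0..T}"
    and \<psi>: "\<And>s. s \<in> {0..T} \<Longrightarrow> (\<psi> has_vector_derivative \<psi>' s) (at s within {0..T})"
    and \<psi>': "continuous_on {0..T} \<psi>'"
  defines "x \<equiv> \<lambda>t. integral {0..t} v"
  shows "(\<lambda>s. x s \<bullet> \<psi>' s + v s \<bullet> \<psi> s) absolutely_integrable_on {0..T}" (is ?int)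
    and "integral {0..T} (\<lambda>s. x s \<bullet> \<psi>' s + v s \<bullet> \<psi> s) = x T \<bullet> \<psi> T"
proof -
  have vi: "v integrable_on {0..T}" and ni: "(\<lambda>s. norm (v s)) integrable_on {0..T}"
    using v by (simp_all add: absolutely_integrable_on_def)
  have contx: "continuous_on {0..T} x"
    unfolding x_def by (rule indefinite_integral_continuous_1[OF vi])
  have cont\<psi>: "continuous_on {0..T} \<psi>"
    using \<psi> by (meson continuous_on_vector_derivative)
  define V where "V t = integral {0..t} (\<lambda>s. norm (v s))" for t
  have contV: "continuous_on {0..T} V"
    unfolding V_def by (rule indefinite_integral_continuous_1[OF ni])
  have incV: "V t - V s = integral {s..t} (\<lambda>s. norm (v s))" if "0 \<le> s" "s \<le> t" "t \<le> T" for s t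
    unfolding V_def using that Henstock_Kurzweil_Integration.integral_combine[of 0 s t "\<lambda>s. norm (v s)"] ni
    by (simp add: integrable_on_subinterval)
  have incx: "x t - x s = integral {s..t} v" if "0 \<le> s" "s \<le> t" "t \<le> T" for s t
    unfolding x_def using that Henstock_Kurzweil_Integration.integral_combine[of 0 s t v] vi
    by (simp add: integrable_on_subinterval algebra_simps)
  have monoV: "V s \<le> V t" if "0 \<le> s" "s \<le> t" "t \<le> T" for s t
  proof -
    have "0 \<le> integral {s..t} (\<lambda>s. norm (v s))"
      by (intro Henstock_Kurzweil_Integration.integral_nonneg integrable_on_subinterval[OF ni])
        (use that in auto)
    then show ?thesis using incV[OF that] by simp
  qed
  have xV: "norm (x t - x s) \<le> V t - V s" if "0 \<le> s" "s \<le> t" "t \<le> T" for s t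
    unfolding incx[OF that] incV[OF that]
    by (intro integral_norm_bound_integral integrable_on_subinterval[OF vi]
          integrable_on_subinterval[OF ni]) (use that in auto)
  have "bounded (\<psi>' ` {0..T})"
    by (intro compact_imp_bounded compact_continuous_image \<psi>') auto
  then obtain K where K: "K > 0" "\<And>s. s \<in> {0..T} \<Longrightarrow> norm (\<psi>' s) \<le> K"
    unfolding bounded_pos by auto
  have inc\<psi>: "(\<psi>' has_integral (\<psi> t - \<psi> s)) {s..t}" if "0 \<le> s" "s \<le> t" "t \<le> T" for s t
    by (intro fundamental_theorem_of_calculus has_vector_derivative_within_subset[OF \<psi>])
      (use that in auto)
  have \<psi>K: "norm (\<psi> t - \<psi> s) \<le> K * (t - s)" if "0 \<le> s" "s \<le> t" "t \<le> T" for s t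
    using has_integral_bound_real[OF _ finite.emptyI inc\<psi>[OF that], of K] K that by auto
  define h where "h = (\<lambda>s. x s \<bullet> \<psi>' s + v s \<bullet> \<psi> s)"
  have "(\<lambda>s. x s \<bullet> \<psi>' s) absolutely_integrable_on {0..T}"
    by (intro absolutely_integrable_continuous_real continuous_intros contx \<psi>')
  moreover have "(\<lambda>s. v s \<bullet> \<psi> s) absolutely_integrable_on {0..T}"
    by (rule continuous_times_absolutely_integrable[OF v cont\<psi>])
  ultimately show int: ?int by (rule set_integral_add)
  then have hi: "h integrable_on {0..T}"
    by (simp add: absolutely_integrable_on_def h_def)
  define D where "D t = x t \<bullet> \<psi> t - integral {0..t} h" for t
  have key: "\<bar>D t - D s\<bar> \<le> ((K * t + 2 * V t) - (K * s + 2 * V s))\<^sup>2"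
    if st: "0 \<le> s" "s \<le> t" "t \<le> T" for s t
  proof -
    have sub: "{s..t} \<subseteq> {0..T}" using st by auto
    have i1: "(\<lambda>r. (x t - x r) \<bullet> \<psi>' r) integrable_on {s..t}"
      by (intro integrable_continuous_interval continuous_intros
            continuous_on_subset[OF contx sub] continuous_on_subset[OF \<psi>' sub])
    have "(\<lambda>r. v r \<bullet> (\<psi> s - \<psi> r)) absolutely_integrable_on {s..t}"
      by (intro continuous_times_absolutely_integrable absolutely_integrable_on_subinterval[OF v sub]
            continuous_on_diff continuous_on_const continuous_on_subset[OF cont\<psi> sub])
    then have i2: "(\<lambda>r. v r \<bullet> (\<psi> s - \<psi> r)) integrable_on {s..t}"
      by (simp add: absolutely_integrable_on_def)
    \<comment> \<open>Freezing \<open>x\<close> at the right end and \<open>\<psi>\<close> at the left end makes the product rule exact on \<open>[s, t]\<close>, as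
      the increments \<open>x t \<bullet> (\<psi> t - \<psi> s)\<close> and \<open>(x t - x s) \<bullet> \<psi> s\<close> add up to the increment of \<open>x \<bullet> \<psi>\<close>.\<close>
    have e1: "((\<lambda>r. x t \<bullet> \<psi>' r) has_integral (x t \<bullet> (\<psi> t - \<psi> s))) {s..t}"
      using has_integral_linear[OF inc\<psi>[OF st] bounded_linear_inner_right[of "x t"]] by (simp add: o_def)
    have e2: "((\<lambda>r. v r \<bullet> \<psi> s) has_integral ((x t - x s) \<bullet> \<psi> s)) {s..t}"
      using has_integral_linear[OF integrable_integral[OF integrable_on_subinterval[OF vi sub]]
          bounded_linear_inner_left[of "\<psi> s"]] incx[OF st] by (simp add: o_def)
    have e3: "(h has_integral (integral {0..t} h - integral {0..s} h)) {s..t}"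
    proof -
      have "integral {0..t} h - integral {0..s} h = integral {s..t} h"
        using Henstock_Kurzweil_Integration.integral_combine[of 0 s t h] st
          integrable_on_subinterval[OF hi, of 0 t] by simp
      then show ?thesis
        using integrable_integral[OF integrable_on_subinterval[OF hi sub]] by simp
    qed
    have "((\<lambda>r. (x t \<bullet> \<psi>' r + v r \<bullet> \<psi> s) - h r) has_integral (D t - D s)) {s..t}"
      using has_integral_diff[OF has_integral_add[OF e1 e2] e3]
      by (simp add: D_def algebra_simps inner_simps)
    then have "((\<lambda>r. (x t - x r) \<bullet> \<psi>' r + v r \<bullet> (\<psi> s - \<psi> r)) has_integral (D t - D s)) {s..t}"
      by (simp add: h_def algebra_simps inner_simps)
    then have "D t - D s = integral {s..t} (\<lambda>r. (x t - x r) \<bullet> \<psi>' r) + integral {s..t} (\<lambda>r. v r \<bullet> (\<psi> s - \<psi> r))"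
      using Henstock_Kurzweil_Integration.integral_add[OF i1 i2] by (simp add: integral_unique)
    moreover have "\<bar>integral {s..t} (\<lambda>r. (x t - x r) \<bullet> \<psi>' r)\<bar> \<le> integral {s..t} (\<lambda>r. (V t - V s) * K)"
      unfolding real_norm_def[symmetric]
    proof (intro integral_norm_bound_integral i1)
      fix r assume r: "r \<in> {s..t}"
      have "norm (x t - x r) \<le> V t - V s"
        using xV[of r t] monoV[of s r] r st by auto
      then show "norm ((x t - x r) \<bullet> \<psi>' r) \<le> (V t - V s) * K"
        unfolding real_norm_def
        using r st K monoV[OF st] by (intro order_trans[OF Cauchy_Schwarz_ineq2] mult_mono) auto
    qed auto
    moreover have "\<bar>integral {s..t} (\<lambda>r. v r \<bullet> (\<psi> s - \<psi> r))\<bar> \<le> integral {s..t} (\<lambda>r. norm (v r) * (K * (t - s)))"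
      unfolding real_norm_def[symmetric]
    proof (intro integral_norm_bound_integral i2 integrable_on_mult_left integrable_on_subinterval[OF ni sub])
      fix r assume r: "r \<in> {s..t}"
      have "norm (\<psi> s - \<psi> r) \<le> K * (r - s)"
        using \<psi>K[of s r] r st by (auto simp: norm_minus_commute)
      also have "\<dots> \<le> K * (t - s)" using r K by (intro mult_left_mono) auto
      finally show "norm (v r \<bullet> (\<psi> s - \<psi> r)) \<le> norm (v r) * (K * (t - s))"
        unfolding real_norm_def by (intro order_trans[OF Cauchy_Schwarz_ineq2] mult_left_mono) auto
    qed
    moreover have "integral {s..t} (\<lambda>r. (V t - V s) * K) = (K * (t - s)) * (V t - V s)"
      using st by simp
    moreover have "integral {s..t} (\<lambda>r. norm (v r) * (K * (t - s))) = (K * (t - s)) * (V t - V s)"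
      using incV[OF st] by simp
    ultimately have "\<bar>D t - D s\<bar> \<le> (K * (t - s)) * (2 * (V t - V s))"
      by linarith
    also have "\<dots> \<le> (K * (t - s) + 2 * (V t - V s))\<^sup>2"
      using st K monoV[OF st] by (auto simp: power2_sum)
    finally show ?thesis by (simp add: algebra_simps)
  qed
  have cont\<phi>: "continuous_on {0..T} (\<lambda>t. K * t + 2 * V t)"
    by (intro continuous_intros contV)
  have mono\<phi>: "K * s + 2 * V s \<le> K * t + 2 * V t" if "0 \<le> s" "s \<le> t" "t \<le> T" for s t
    using that K monoV[OF that] by (intro add_mono mult_left_mono) auto
  have "D T \<le> D 0"
    by (rule nonincreasing_if_increments_quadratic[OF T cont\<phi> mono\<phi>, where F = D])
      (use key in \<open>auto simp: abs_le_iff\<close>)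
  moreover have "- D T \<le> - D 0"
    by (rule nonincreasing_if_increments_quadratic[OF T cont\<phi> mono\<phi>, where F = "\<lambda>t. - D t"])
      (use key in \<open>auto simp: abs_le_iff\<close>)
  ultimately have D: "D T = D 0" by simp
  have "x 0 = 0" by (simp add: x_def)
  then have "D T = 0" using D by (simp add: D_def)
  then show "integral {0..T} (\<lambda>s. x s \<bullet> \<psi>' s + v s \<bullet> \<psi> s) = x T \<bullet> \<psi> T"
    by (simp add: D_def h_def)
qed

section \<open>The matrix exponential\<close>

abbreviation matrix_power :: "real ^ 'n ^ 'n \<Rightarrow> nat \<Rightarrow> real ^ 'n ^ 'n" where
  "matrix_power Q k \<equiv> ((**) Q ^^ k) (mat 1)"

lemma matrix_power_Suc2: "matrix_power Q (Suc k) = matrix_power Q k ** Q"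
  by (induction k) (simp_all add: matrix_mul_assoc)

lemma matrix_power_scaleR: "matrix_power (t *\<^sub>R Q) k = t ^ k *\<^sub>R matrix_power Q k"
proof (induction k)
  case (Suc k)
  then show ?case
    by (simp add: vec_eq_iff matrix_matrix_mult_def sum_distrib_left mult_ac)
qed simp

text \<open>
The bound by a geometric sequence makes each entry of \<open>exp (t Q)\<close> a real power series in \<open>t\<close> that
converges everywhere, so that the exponential can be differentiated entry by entry.
\<close>

lemma matrix_power_entry_bound:
  "\<bar>matrix_power Q k $ i $ j\<bar> \<le> (\<Sum>a\<in>UNIV. \<Sum>b\<in>UNIV. \<bar>Q $ a $ b\<bar>) ^ k"
proof (induction k arbitrary: i j)
  case 0
  then show ?case by (simp add: mat_def)
next
  case (Suc k)
  define K where "K = (\<Sum>a\<in>UNIV. \<Sum>b\<in>UNIV. \<bar>Q $ a $ b\<bar>)"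
  have K: "0 \<le> K" by (simp add: K_def sum_nonneg)
  have "\<bar>matrix_power Q (Suc k) $ i $ j\<bar> \<le> (\<Sum>l\<in>UNIV. \<bar>Q $ i $ l\<bar> * K ^ k)"
  proof -
    have "\<bar>matrix_power Q (Suc k) $ i $ j\<bar> = \<bar>\<Sum>l\<in>UNIV. Q $ i $ l * matrix_power Q k $ l $ j\<bar>"
      by (simp only: funpow.simps o_apply matrix_matrix_mult_def vec_lambda_beta)
    also have "\<dots> \<le> (\<Sum>l\<in>UNIV. \<bar>Q $ i $ l * matrix_power Q k $ l $ j\<bar>)" by (rule sum_abs)
    also have "\<dots> \<le> (\<Sum>l\<in>UNIV. \<bar>Q $ i $ l\<bar> * K ^ k)"
      unfolding abs_mult using Suc.IH by (intro sum_mono mult_left_mono) (auto simp: K_def)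
    finally show ?thesis .
  qed
  also have "\<dots> = (\<Sum>l\<in>UNIV. \<bar>Q $ i $ l\<bar>) * K ^ k"
    by (simp add: sum_distrib_right)
  also have "\<dots> \<le> K * K ^ k"
    using K by (intro mult_right_mono) (auto simp: K_def intro!: member_le_sum sum_nonneg)
  finally show ?case by (simp add: K_def)
qed

definition exp_entry_coeff :: "real ^ 'n ^ 'n \<Rightarrow> 'n \<Rightarrow> 'n \<Rightarrow> nat \<Rightarrow> real" where
  "exp_entry_coeff Q i j k = matrix_power Q k $ i $ j / fact k"

lemma summable_exp_entry: "summable (\<lambda>k. exp_entry_coeff Q i j k * t ^ k)"
proof (rule summable_comparison_test')
  define K where "K = (\<Sum>a\<in>UNIV. \<Sum>b\<in>UNIV. \<bar>Q $ a $ b\<bar>)"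
  show "summable (\<lambda>k. inverse (fact k) * (K * \<bar>t\<bar>) ^ k)" by (rule summable_exp)
  fix k
  have "\<bar>matrix_power Q k $ i $ j\<bar> * \<bar>t\<bar> ^ k \<le> K ^ k * \<bar>t\<bar> ^ k"
    unfolding K_def by (intro mult_right_mono matrix_power_entry_bound) auto
  then show "norm (exp_entry_coeff Q i j k * t ^ k) \<le> inverse (fact k) * (K * \<bar>t\<bar>) ^ k"
    by (simp add: exp_entry_coeff_def abs_mult power_abs field_simps power_mult_distrib)
qed

lemma matrix_exp_entry:
  "matrix_exp (t *\<^sub>R Q) $ i $ j = (\<Sum>k. exp_entry_coeff Q i j k * t ^ k)"
proof -
  have "(\<lambda>k. (1 / fact k) *\<^sub>R matrix_power (t *\<^sub>R Q) k) sums
        (\<chi> i j. \<Sum>k. exp_entry_coeff Q i j k * t ^ k)"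
    unfolding sums_def
  proof (intro vec_tendstoI)
    fix i j
    have "(\<lambda>k. exp_entry_coeff Q i j k * t ^ k) sums (\<Sum>k. exp_entry_coeff Q i j k * t ^ k)"
      by (rule summable_sums[OF summable_exp_entry])
    then show "(\<lambda>n. (\<Sum>k<n. (1 / fact k) *\<^sub>R matrix_power (t *\<^sub>R Q) k) $ i $ j)
       \<longlonglongrightarrow> (\<chi> i j. \<Sum>k. exp_entry_coeff Q i j k * t ^ k) $ i $ j"
      by (simp add: sums_def matrix_power_scaleR exp_entry_coeff_def mult_ac)
  qed
  then have "matrix_exp (t *\<^sub>R Q) = (\<chi> i j. \<Sum>k. exp_entry_coeff Q i j k * t ^ k)"
    unfolding matrix_exp_def by (rule sums_unique[symmetric])
  then show ?thesis by simp
qed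

lemma matrix_exp_entry_0: "matrix_exp (0 *\<^sub>R Q) $ i $ j = mat 1 $ i $ j"
  unfolding matrix_exp_entry powser_zero by (simp add: exp_entry_coeff_def)

lemma matrix_exp_entry_deriv:
  "((\<lambda>t. matrix_exp (t *\<^sub>R Q) $ i $ j) has_real_derivative
     (\<Sum>l\<in>UNIV. matrix_exp (t *\<^sub>R Q) $ i $ l * Q $ l $ j)) (at t)"
proof -
  have "diffs (exp_entry_coeff Q i j) k = (\<Sum>l\<in>UNIV. exp_entry_coeff Q i l k * Q $ l $ j)" for k
  proof -
    have "diffs (exp_entry_coeff Q i j) k = matrix_power Q (Suc k) $ i $ j / fact k"
      unfolding diffs_def exp_entry_coeff_def by (simp del: funpow.simps of_nat_Suc)
    then show ?thesis
      by (subst (asm) matrix_power_Suc2)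
        (simp add: matrix_matrix_mult_def exp_entry_coeff_def sum_divide_distrib)
  qed
  then have "(\<Sum>k. diffs (exp_entry_coeff Q i j) k * t ^ k)
      = (\<Sum>k. \<Sum>l\<in>UNIV. (exp_entry_coeff Q i l k * t ^ k) * Q $ l $ j)"
    by (simp add: sum_distrib_left mult_ac)
  also have "\<dots> = (\<Sum>l\<in>UNIV. \<Sum>k. (exp_entry_coeff Q i l k * t ^ k) * Q $ l $ j)"
    by (intro suminf_sum summable_mult2 summable_exp_entry)
  also have "\<dots> = (\<Sum>l\<in>UNIV. matrix_exp (t *\<^sub>R Q) $ i $ l * Q $ l $ j)"
    by (simp add: matrix_exp_entry suminf_mult2[OF summable_exp_entry])
  finally show ?thesis
    unfolding matrix_exp_entry
    using termdiffs_strong_converges_everywhere[OF summable_exp_entry[of Q i j], of t] by simp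
qed

text \<open>
Kernels and trajectories are only ever tested against a fixed vector \<open>w\<close>; this curve carries
all exponentials that have been moved to the side of \<open>w\<close>.
\<close>

definition adjoint_flow :: "real ^ 'n ^ 'n \<Rightarrow> real ^ 'n \<Rightarrow> real \<Rightarrow> real ^ 'n" where
  "adjoint_flow Q w t = transpose (matrix_exp (t *\<^sub>R Q)) *v w"

lemma inner_transpose: "w \<bullet> (Q *v v) = (transpose Q *v w) \<bullet> (v :: real ^ 'n)"
  by (simp only: transpose_matrix_vector dot_lmul_matrix)

lemma inner_matrix_exp: "w \<bullet> (matrix_exp (t *\<^sub>R Q) *v v) = adjoint_flow Q w t \<bullet> v"
  unfolding adjoint_flow_def by (rule inner_transpose)

lemma adjoint_flow_0 [simp]: "adjoint_flow Q w 0 = w"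
proof -
  have "matrix_exp (0 *\<^sub>R Q) = mat 1"
    by (simp only: vec_eq_iff matrix_exp_entry_0) simp
  then show ?thesis unfolding adjoint_flow_def by (simp only: transpose_mat matrix_vector_mul_lid)
qed

lemma adjoint_flow_nth: "adjoint_flow Q w t $ j = (\<Sum>i\<in>UNIV. matrix_exp (t *\<^sub>R Q) $ i $ j * w $ i)"
  by (simp add: adjoint_flow_def matrix_vector_mult_def transpose_def)

lemma adjoint_flow_deriv:
  "(adjoint_flow Q w has_vector_derivative (transpose Q *v adjoint_flow Q w t)) (at t within S)"
proof -
  have entry: "((\<lambda>t. adjoint_flow Q w t $ j) has_real_derivative (transpose Q *v adjoint_flow Q w t) $ j) (at t)" for j
  proof -
    have "((\<lambda>t. \<Sum>i\<in>UNIV. matrix_exp (t *\<^sub>R Q) $ i $ j * w $ i) has_real_derivative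
        (\<Sum>i\<in>UNIV. (\<Sum>l\<in>UNIV. matrix_exp (t *\<^sub>R Q) $ i $ l * Q $ l $ j) * w $ i)) (at t)"
      by (intro DERIV_sum DERIV_cmult_right matrix_exp_entry_deriv)
    moreover have "(\<Sum>i\<in>UNIV. (\<Sum>l\<in>UNIV. matrix_exp (t *\<^sub>R Q) $ i $ l * Q $ l $ j) * w $ i)
       = (\<Sum>l\<in>UNIV. \<Sum>i\<in>UNIV. matrix_exp (t *\<^sub>R Q) $ i $ l * Q $ l $ j * w $ i)"
      unfolding sum_distrib_right by (rule sum.swap)
    moreover have "\<dots> = (\<Sum>l\<in>UNIV. Q $ l $ j * adjoint_flow Q w t $ l)"
      unfolding adjoint_flow_nth sum_distrib_left by (intro sum.cong refl) (simp add: mult_ac)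
    moreover have "\<dots> = (transpose Q *v adjoint_flow Q w t) $ j"
      by (simp only: matrix_vector_mult_def transpose_def vec_lambda_beta)
    ultimately show ?thesis unfolding adjoint_flow_nth by simp
  qed
  have "(adjoint_flow Q w has_vector_derivative (transpose Q *v adjoint_flow Q w t)) (at t)"
    unfolding has_vector_derivative_def
  proof (rule has_derivative_componentwise_within[THEN iffD2], intro ballI)
    fix b :: "real ^ 'a" assume "b \<in> Basis"
    then obtain j where b: "b = axis j 1" by (auto simp: Basis_vec_def)
    show "((\<lambda>t. adjoint_flow Q w t \<bullet> b) has_derivative
       (\<lambda>h. (h *\<^sub>R (transpose Q *v adjoint_flow Q w t)) \<bullet> b)) (at t)"
      using entry[of j]
      by (simp only: b cart_eq_inner_axis[symmetric] vector_scaleR_component real_scaleR_def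
          has_field_derivative_def mult_commute_abs)
  qed
  then show ?thesis by (rule has_vector_derivative_at_within)
qed

lemma continuous_on_matrix_exp_entry: "continuous_on S (\<lambda>t. matrix_exp (t *\<^sub>R Q) $ i $ j)"
  by (intro continuous_at_imp_continuous_on ballI DERIV_isCont[OF matrix_exp_entry_deriv])

lemma continuous_on_adjoint_flow: "continuous_on S (adjoint_flow Q w)"
  by (rule continuous_on_vector_derivative[OF adjoint_flow_deriv])

lemma adjoint_flow_bounded:
  obtains K where "K > 0" "\<And>t w. t \<in> {0..T} \<Longrightarrow> norm (adjoint_flow Q w t) \<le> K * norm w"
proof -
  define k where "k t = (\<Sum>i\<in>UNIV. \<Sum>j\<in>UNIV. \<bar>matrix_exp (t *\<^sub>R Q) $ i $ j\<bar>)" for t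
  have "bounded (k ` {0..T})"
    unfolding k_def
    by (intro compact_imp_bounded compact_continuous_image continuous_intros
        continuous_on_matrix_exp_entry) auto
  then obtain K where K: "K > 0" "\<And>t. t \<in> {0..T} \<Longrightarrow> norm (k t) \<le> K"
    unfolding bounded_pos by auto
  have "norm (adjoint_flow Q w t) \<le> K * norm w" if "t \<in> {0..T}" for t w
  proof -
    have "norm (adjoint_flow Q w t) \<le> (\<Sum>j\<in>UNIV. \<bar>adjoint_flow Q w t $ j\<bar>)"
      by (rule norm_le_l1_cart)
    also have "\<dots> \<le> (\<Sum>j\<in>UNIV. \<Sum>i\<in>UNIV. \<bar>matrix_exp (t *\<^sub>R Q) $ i $ j\<bar> * norm w)"
      unfolding adjoint_flow_nth
      by (auto simp: abs_mult component_le_norm_cart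
          intro!: sum_mono order_trans[OF sum_abs] mult_left_mono)
    also have "\<dots> = k t * norm w"
      by (subst sum.swap) (simp add: k_def sum_distrib_right)
    also have "\<dots> \<le> K * norm w"
      using K(2)[OF that] by (intro mult_right_mono) auto
    finally show ?thesis .
  qed
  with K(1) show ?thesis using that by blast
qed

section \<open>Kernel energies\<close>

lemma N_block_kron_axis: "N_block S *v (axis k 1 \<otimes>\<^sub>v v) = sysN S k *v v"
proof -
  have "(\<Sum>kb\<in>UNIV. sysN S (fst kb) $ a $ snd kb * (axis k 1 $ fst kb * v $ snd kb))
      = (\<Sum>b\<in>UNIV. sysN S k $ a $ b * v $ b)" for a
  proof -
    have "(\<Sum>kb\<in>UNIV. sysN S (fst kb) $ a $ snd kb * (axis k 1 $ fst kb * v $ snd kb))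
        = (\<Sum>k'\<in>UNIV. \<Sum>b\<in>UNIV. sysN S k' $ a $ b * (axis k 1 $ k' * v $ b))"
      unfolding sum.cartesian_product UNIV_Times_UNIV by (simp add: case_prod_beta)
    also have "\<dots> = (\<Sum>k'\<in>UNIV. if k' = k then \<Sum>b\<in>UNIV. sysN S k $ a $ b * v $ b else 0)"
      by (intro sum.cong refl) (auto simp: axis_def)
    finally show ?thesis by simp
  qed
  then show ?thesis
    by (simp add: vec_eq_iff matrix_vector_mult_def N_block_def kron_vec_def)
qed

text \<open>
The unit vector in the Kronecker product selects the block \<open>N\<^sub>k\<close> of \<open>\<N>\<close>.
\<close>

lemma Pbar_Cons:
  "ks \<noteq> [] \<Longrightarrow> Pbar S t (k # ks) = matrix_exp (t (length (k # ks)) *\<^sub>R sysA S) *v (sysN S k *v Pbar S t ks)"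
  by (cases ks) (simp_all add: N_block_kron_axis)

lemma Pbar_fun_upd: "length ks < i \<Longrightarrow> Pbar S (t(i := y)) ks = Pbar S t ks"
proof (induction ks)
  case (Cons k ks)
  then show ?case by (cases "ks = []") (auto simp: Pbar_Cons)
qed simp

abbreviation time_measure :: "nat \<Rightarrow> (nat \<Rightarrow> real) measure" where
  "time_measure i \<equiv> Pi\<^sub>M {1..i} (\<lambda>_. lborel)"

lemma measurable_matrix_exp_mult:
  assumes [measurable]: "f \<in> borel_measurable M" "g \<in> borel_measurable M"
  shows "(\<lambda>x. matrix_exp (f x *\<^sub>R Q) *v g x) \<in> borel_measurable M"
proof (rule borel_measurable_continuous_Pair[where H = "\<lambda>t v. matrix_exp (t *\<^sub>R Q) *v v"])
  have *: "continuous_on UNIV (\<lambda>x :: real \<times> _. matrix_exp (fst x *\<^sub>R Q) $ i $ j)" for i j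
    by (rule continuous_on_compose2[OF continuous_on_matrix_exp_entry[of UNIV]]) (auto intro: continuous_intros)
  show "continuous_on UNIV (\<lambda>x. matrix_exp (fst x *\<^sub>R Q) *v snd x)"
    unfolding matrix_vector_mult_def
    by (intro continuous_on_vec_lambda continuous_on_sum continuous_on_mult * continuous_on_component
        continuous_on_snd continuous_on_id)
qed (use assms in auto)

lemma measurable_Pbar:
  "length ks \<le> i \<Longrightarrow> (\<lambda>t. Pbar S t ks) \<in> borel_measurable (time_measure i)"
proof (induction ks)
  case (Cons k ks)
  have t: "(\<lambda>t. t (length (k # ks))) \<in> borel_measurable (time_measure i)"
    using measurable_component_singleton[of "length (k # ks)" "{1..i}" "\<lambda>_. lborel :: real measure"] Cons.prems
    by simp
  show ?case
  proof (cases "ks = []")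
    case True
    have "(\<lambda>t. matrix_exp (t (length (k # ks)) *\<^sub>R sysA S) *v column k (sysB S))
        \<in> borel_measurable (time_measure i)"
      by (intro measurable_matrix_exp_mult t borel_measurable_const)
    with True show ?thesis by simp
  next
    case False
    have IH: "(\<lambda>t. Pbar S t ks) \<in> borel_measurable (time_measure i)"
      using Cons by simp
    have "(\<lambda>t. sysN S k *v Pbar S t ks) \<in> borel_measurable (time_measure i)"
      by (rule borel_measurable_continuous_on[OF _ IH, of "\<lambda>v. sysN S k *v v"])
        (auto intro: matrix_vector_mult_linear_continuous_on)
    then have "(\<lambda>t. matrix_exp (t (length (k # ks)) *\<^sub>R sysA S) *v (sysN S k *v Pbar S t ks))
        \<in> borel_measurable (time_measure i)"
      by (intro measurable_matrix_exp_mult t)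
    with False show ?thesis by (simp add: Pbar_Cons del: length_Cons)
  qed
qed simp

lemma finite_col_indices: "finite (col_indices i :: 'm::finite list set)"
  unfolding col_indices_def using finite_lists_length_eq[of "UNIV :: 'm set" i] by simp

lemma sum_col_indices_Suc:
  "(\<Sum>ks\<in>col_indices (Suc i). f ks) = (\<Sum>k\<in>UNIV. \<Sum>ks\<in>col_indices i. f (k # ks))"
  for f :: "'m::finite list \<Rightarrow> 'b::comm_monoid_add"
proof -
  have "bij_betw (\<lambda>(k, ks). k # ks) (UNIV \<times> col_indices i) (col_indices (Suc i) :: 'm list set)"
    by (rule bij_betw_byWitness[where f' = "\<lambda>ks. (hd ks, tl ks)"])
      (auto simp: col_indices_def length_Suc_conv)
  from sum.reindex_bij_betw[OF this, of f]
  show ?thesis by (simp add: sum.cartesian_product case_prod_beta)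
qed

text \<open>
The squared norm of \<open>w\<^sup>T P\<^sub>i\<close> in \<open>L\<^sup>2\<close>, which is the quadratic form of the \<open>i\<close>-th summand of the
controllability Gramian.
\<close>

definition kernel_energy ::
  "('n::finite, 'm::finite, 'p::finite) bqo \<Rightarrow> nat \<Rightarrow> real ^ 'n \<Rightarrow> ennreal" where
  "kernel_energy S i w = (\<integral>\<^sup>+ t \<in> nonneg_orthant i.
     ennreal (\<Sum>ks\<in>col_indices i. (w \<bullet> Pbar S t ks)\<^sup>2) \<partial>time_measure i)"

definition total_energy :: "('n::finite, 'm::finite, 'p::finite) bqo \<Rightarrow> real ^ 'n \<Rightarrow> ennreal" where
  "total_energy S w = (\<Sum>i. kernel_energy S (Suc i) w)"

lemma nonneg_orthant_measurable [measurable]: "nonneg_orthant i \<in> sets (time_measure i)"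
  unfolding nonneg_orthant_def by (intro sets_PiM_I_finite) auto

lemma measurable_kernel_integrand [measurable]:
  "(\<lambda>t. \<Sum>ks\<in>col_indices i. (w \<bullet> Pbar S t ks)\<^sup>2) \<in> borel_measurable (time_measure i)"
  by (intro borel_measurable_sum borel_measurable_power borel_measurable_inner measurable_Pbar
      borel_measurable_const) (auto simp: col_indices_def)

lemma product_sigma_finite_lborel: "product_sigma_finite (\<lambda>_::nat. lborel :: real measure)"
  by (simp add: product_sigma_finite_def sigma_finite_lborel)

lemma sigma_finite_time_measure: "sigma_finite_measure (time_measure i)"
  by (rule product_sigma_finite.sigma_finite[OF product_sigma_finite_lborel]) simp

lemma measurable_kernel_energy [measurable]: "kernel_energy S i \<in> borel_measurable borel"
proof -
  interpret sigma_finite_measure "time_measure i" by (rule sigma_finite_time_measure)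
  have "(\<lambda>x. Pbar S (snd x) ks) \<in> borel_measurable (borel \<Otimes>\<^sub>M time_measure i)" if "ks \<in> col_indices i" for ks
    using that by (intro measurable_compose[OF measurable_snd measurable_Pbar]) (auto simp: col_indices_def)
  then have [measurable]: "(\<lambda>x. \<Sum>ks\<in>col_indices i. (fst x \<bullet> Pbar S (snd x) ks)\<^sup>2)
      \<in> borel_measurable (borel \<Otimes>\<^sub>M time_measure i)"
    by (intro borel_measurable_sum borel_measurable_power borel_measurable_inner
        measurable_compose[OF measurable_fst]) auto
  have "(\<lambda>w. \<integral>\<^sup>+ t. ennreal (\<Sum>ks\<in>col_indices i. (w \<bullet> Pbar S t ks)\<^sup>2) * indicator (nonneg_orthant i) t
      \<partial>time_measure i) \<in> borel_measurable borel"
    by (rule borel_measurable_nn_integral, unfold case_prod_beta) measurable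
  then show ?thesis unfolding kernel_energy_def[abs_def] .
qed

lemma measurable_total_energy [measurable]: "total_energy S \<in> borel_measurable borel"
  unfolding total_energy_def[abs_def] by measurable

text \<open>
The time of the outermost exponential has the largest index; it becomes the outer variable.
\<close>

lemma nn_integral_nonneg_orthant_Suc:
  fixes f :: "(nat \<Rightarrow> real) \<Rightarrow> ennreal"
  assumes [measurable]: "f \<in> borel_measurable (time_measure (Suc i))"
  shows "(\<integral>\<^sup>+ t \<in> nonneg_orthant (Suc i). f t \<partial>time_measure (Suc i)) =
    (\<integral>\<^sup>+ \<tau> \<in> {0..}. (\<integral>\<^sup>+ t \<in> nonneg_orthant i. f (t(Suc i := \<tau>)) \<partial>time_measure i) \<partial>lborel)"
proof -
  interpret product_sigma_finite "\<lambda>_::nat. lborel :: real measure"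
    by (rule product_sigma_finite_lborel)
  have ins: "{1..Suc i} = insert (Suc i) {1..i}" by auto
  have "(\<integral>\<^sup>+ t. f t * indicator (nonneg_orthant (Suc i)) t \<partial>time_measure (Suc i)) =
    (\<integral>\<^sup>+ \<tau>. (\<integral>\<^sup>+ t. f (t(Suc i := \<tau>)) * indicator (nonneg_orthant (Suc i)) (t(Suc i := \<tau>))
       \<partial>time_measure i) \<partial>lborel)"
    by (rule product_nn_integral_insert_rev[of "{1..i}" "Suc i", folded ins]) (simp, simp, measurable)
  also have "\<dots> = (\<integral>\<^sup>+ \<tau>. (\<integral>\<^sup>+ t. (f (t(Suc i := \<tau>)) * indicator (nonneg_orthant i) t) * indicator {0..} \<tau>
       \<partial>time_measure i) \<partial>lborel)"
  proof (intro nn_integral_cong)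
    fix \<tau> t assume "t \<in> space (time_measure i)"
    then have "indicator (nonneg_orthant (Suc i)) (t(Suc i := \<tau>)) =
        (indicator (nonneg_orthant i) t * indicator {0..} \<tau> :: ennreal)"
      by (auto simp: nonneg_orthant_def space_PiM PiE_iff extensional_def indicator_def le_Suc_eq)
    then show "f (t(Suc i := \<tau>)) * indicator (nonneg_orthant (Suc i)) (t(Suc i := \<tau>)) =
       (f (t(Suc i := \<tau>)) * indicator (nonneg_orthant i) t) * indicator {0..} \<tau>"
      by (simp add: mult_ac)
  qed
  also have "\<dots> = (\<integral>\<^sup>+ \<tau> \<in> {0..}. (\<integral>\<^sup>+ t \<in> nonneg_orthant i. f (t(Suc i := \<tau>)) \<partial>time_measure i) \<partial>lborel)"
  proof (intro nn_integral_cong nn_integral_multc)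
    fix \<tau> :: real
    have "(\<lambda>t. t(Suc i := \<tau>)) \<in> time_measure i \<rightarrow>\<^sub>M time_measure (Suc i)"
      unfolding ins by measurable
    then show "(\<lambda>t. f (t(Suc i := \<tau>)) * indicator (nonneg_orthant i) t) \<in> borel_measurable (time_measure i)"
      by measurable
  qed
  finally show ?thesis .
qed

lemma inner_column: "v \<bullet> column k B = (transpose B *v v) $ k"
  by (simp add: inner_vec_def column_def matrix_vector_mult_def transpose_def mult.commute)

lemma kernel_energy_1:
  "kernel_energy S (Suc 0) w =
    (\<integral>\<^sup>+ \<tau> \<in> {0..}. ennreal ((norm (transpose (sysB S) *v adjoint_flow (sysA S) w \<tau>))\<^sup>2) \<partial>lborel)"
proof -
  have *: "(\<Sum>ks\<in>col_indices (Suc 0). (w \<bullet> Pbar S (t(Suc 0 := \<tau>)) ks)\<^sup>2)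
      = (norm (transpose (sysB S) *v adjoint_flow (sysA S) w \<tau>))\<^sup>2" for t \<tau>
    unfolding sum_col_indices_Suc
    by (simp add: col_indices_def inner_matrix_exp inner_column norm_vec_def L2_set_def sum_nonneg)
  show ?thesis
    unfolding kernel_energy_def
    by (subst nn_integral_nonneg_orthant_Suc[OF measurable_compose[OF measurable_kernel_integrand measurable_ennreal]])
      (simp_all add: * nonneg_orthant_def space_PiM PiM_empty nn_integral_count_space_finite)
qed

text \<open>
In column \<open>(k, ks)\<close> the kernel is \<open>exp (\<tau> A) N\<^sub>k\<close> applied to column \<open>ks\<close> of the previous kernel. Both
factors go over to the side of \<open>w\<close>.
\<close>

lemma kernel_energy_Suc:
  "kernel_energy S (Suc (Suc i)) w =
    (\<integral>\<^sup>+ \<tau> \<in> {0..}. (\<Sum>k\<in>UNIV. kernel_energy S (Suc i) (transpose (sysN S k) *v adjoint_flow (sysA S) w \<tau>)) \<partial>lborel)"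
proof -
  have *: "(\<Sum>ks\<in>col_indices (Suc (Suc i)). (w \<bullet> Pbar S (t(Suc (Suc i) := \<tau>)) ks)\<^sup>2)
      = (\<Sum>k\<in>UNIV. \<Sum>ks\<in>col_indices (Suc i).
          ((transpose (sysN S k) *v adjoint_flow (sysA S) w \<tau>) \<bullet> Pbar S t ks)\<^sup>2)" for t \<tau>
    unfolding sum_col_indices_Suc[of _ "Suc i"]
  proof (intro sum.cong refl)
    fix k ks assume "ks \<in> (col_indices (Suc i) :: 'b list set)"
    then have ks: "length ks = Suc i" "ks \<noteq> []" by (auto simp: col_indices_def)
    have "Pbar S (t(Suc (Suc i) := \<tau>)) (k # ks)
        = matrix_exp (\<tau> *\<^sub>R sysA S) *v (sysN S k *v Pbar S t ks)"
      using ks by (simp add: Pbar_Cons Pbar_fun_upd)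
    then show "(w \<bullet> Pbar S (t(Suc (Suc i) := \<tau>)) (k # ks))\<^sup>2
      = ((transpose (sysN S k) *v adjoint_flow (sysA S) w \<tau>) \<bullet> Pbar S t ks)\<^sup>2"
      by (simp only: inner_matrix_exp inner_transpose[of _ "sysN S k"])
  qed
  show ?thesis
    unfolding kernel_energy_def[of S "Suc (Suc i)"]
  proof (subst nn_integral_nonneg_orthant_Suc, measurable, intro nn_integral_cong)
    fix \<tau> :: real
    show "(\<integral>\<^sup>+ t\<in>nonneg_orthant (Suc i). ennreal (\<Sum>ks\<in>col_indices (Suc (Suc i)).
            (w \<bullet> Pbar S (t(Suc (Suc i) := \<tau>)) ks)\<^sup>2) \<partial>time_measure (Suc i)) * indicator {0..} \<tau> =
       (\<Sum>k\<in>UNIV. kernel_energy S (Suc i) (transpose (sysN S k) *v adjoint_flow (sysA S) w \<tau>)) * indicator {0..} \<tau>"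
    proof -
      have "ennreal (\<Sum>k\<in>UNIV. \<Sum>ks\<in>col_indices (Suc i). (v k \<bullet> Pbar S t ks)\<^sup>2) =
          (\<Sum>k\<in>UNIV. ennreal (\<Sum>ks\<in>col_indices (Suc i). (v k \<bullet> Pbar S t ks)\<^sup>2))"
        for t and v :: "'b \<Rightarrow> real ^ 'a"
        by (rule sum_ennreal[symmetric]) (simp add: sum_nonneg)
      then have "(\<integral>\<^sup>+ t\<in>nonneg_orthant (Suc i). ennreal (\<Sum>k\<in>UNIV. \<Sum>ks\<in>col_indices (Suc i).
            (v k \<bullet> Pbar S t ks)\<^sup>2) \<partial>time_measure (Suc i)) = (\<Sum>k\<in>UNIV. kernel_energy S (Suc i) (v k))"
        for v :: "'b \<Rightarrow> real ^ 'a"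
        unfolding kernel_energy_def by (simp only: sum_distrib_right) (rule nn_integral_sum, measurable)
      then show ?thesis unfolding * by simp
    qed
  qed
qed

lemma measurable_adjoint_flow [measurable]: "adjoint_flow Q w \<in> borel_measurable borel"
  by (intro borel_measurable_continuous_onI continuous_on_adjoint_flow)

lemma measurable_matrix_vector_mult [measurable]:
  fixes Q :: "real ^ 'n ^ 'm"
  shows "f \<in> borel_measurable M \<Longrightarrow> (\<lambda>x. Q *v f x) \<in> borel_measurable M"
  by (rule borel_measurable_continuous_on[of "\<lambda>v. Q *v v"])
    (auto intro: matrix_vector_mult_linear_continuous_on)

lemma total_energy_eq:
  "total_energy S w = (\<integral>\<^sup>+ \<tau> \<in> {0..}.
     (ennreal ((norm (transpose (sysB S) *v adjoint_flow (sysA S) w \<tau>))\<^sup>2) +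
      (\<Sum>k\<in>UNIV. total_energy S (transpose (sysN S k) *v adjoint_flow (sysA S) w \<tau>))) \<partial>lborel)"
proof -
  define b where "b \<tau> = ennreal ((norm (transpose (sysB S) *v adjoint_flow (sysA S) w \<tau>))\<^sup>2)" for \<tau>
  define e where "e \<tau> = (\<Sum>k\<in>UNIV. total_energy S (transpose (sysN S k) *v adjoint_flow (sysA S) w \<tau>))" for \<tau>
  have [measurable]: "b \<in> borel_measurable borel" "e \<in> borel_measurable borel"
    unfolding b_def e_def by measurable
  have "total_energy S w = kernel_energy S (Suc 0) w + (\<Sum>i. kernel_energy S (Suc (Suc i)) w)"
    unfolding total_energy_def by (subst add.commute)
      (rule sums_unique[symmetric, OF sums_Suc[OF summable_sums[OF summableI]]])
  also have "(\<Sum>i. kernel_energy S (Suc (Suc i)) w) = (\<integral>\<^sup>+ \<tau> \<in> {0..}.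
      (\<Sum>k\<in>UNIV. total_energy S (transpose (sysN S k) *v adjoint_flow (sysA S) w \<tau>)) \<partial>lborel)"
  proof -
    have "(\<Sum>k\<in>UNIV. total_energy S (v k)) = (\<Sum>i. \<Sum>k\<in>UNIV. kernel_energy S (Suc i) (v k))"
      for v :: "'b \<Rightarrow> real ^ 'a"
      unfolding total_energy_def by (rule suminf_sum[symmetric]) (rule summableI)
    then show ?thesis
      unfolding kernel_energy_Suc
      by (simp only: ennreal_suminf_multc[symmetric]) (rule nn_integral_suminf[symmetric], measurable)
  qed
  finally have "total_energy S w = (\<integral>\<^sup>+ \<tau> \<in> {0..}. b \<tau> \<partial>lborel) + (\<integral>\<^sup>+ \<tau> \<in> {0..}. e \<tau> \<partial>lborel)"
    unfolding kernel_energy_1 b_def e_def .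
  also have "\<dots> = (\<integral>\<^sup>+ \<tau> \<in> {0..}. (b \<tau> + e \<tau>) \<partial>lborel)"
    unfolding distrib_right by (rule nn_integral_add[symmetric]) simp_all
  finally show ?thesis unfolding b_def e_def .
qed

section \<open>Finiteness of the energy\<close>

text \<open>
Along \<open>\<psi>(\<tau>) = exp (\<tau> A)\<^sup>T w\<close> the quantity \<open>\<psi> \<bullet> P \<psi>\<close> stays nonnegative and decreases at least at the
rate given by the last two terms of the hypothesis. The integral of this rate is therefore at
most the initial value \<open>w \<bullet> P w\<close>. Induction on the number of kernels turns this into a bound for their
energies, because each kernel energy is the integral of the previous one at \<open>N\<^sub>k\<^sup>T \<psi>\<close>.
\<close>

lemma total_energy_le:
  fixes S :: "('n::finite, 'm::finite, 'p::finite) bqo" and P :: "real ^ 'n ^ 'n"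
  assumes P: "sym_pos_semidef P"
    and diss: "\<And>w. 2 * ((transpose (sysA S) *v w) \<bullet> (P *v w)) +
       (\<Sum>k\<in>UNIV. (transpose (sysN S k) *v w) \<bullet> (P *v (transpose (sysN S k) *v w))) +
       (norm (transpose (sysB S) *v w))\<^sup>2 \<le> 0"
  shows "total_energy S w \<le> ennreal (w \<bullet> (P *v w))"
proof -
  define q where "q w = w \<bullet> (P *v w)" for w
  have q: "q w \<ge> 0" for w using P by (simp add: q_def sym_pos_semidef_def)
  define g where "g w = (norm (transpose (sysB S) *v w))\<^sup>2 + (\<Sum>k\<in>UNIV. q (transpose (sysN S k) *v w))" for w
  have g: "g w \<ge> 0" for w unfolding g_def by (intro add_nonneg_nonneg sum_nonneg q) simp
  have sym: "v \<bullet> (P *v w) = w \<bullet> (P *v v)" for v w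
    using P inner_transpose[of v P w] by (simp add: sym_pos_semidef_def symmetric_matrix_def inner_commute)
  have flow: "(\<integral>\<^sup>+ \<tau> \<in> {0..}. ennreal (g (adjoint_flow (sysA S) w \<tau>)) \<partial>lborel) \<le> ennreal (q w)" for w
  proof -
    define \<psi> where "\<psi> = adjoint_flow (sysA S) w"
    have m [measurable]: "(\<lambda>\<tau>. g (\<psi> \<tau>)) \<in> borel_measurable borel"
      unfolding g_def q_def \<psi>_def by measurable
    have d\<psi>: "(\<psi> has_vector_derivative (transpose (sysA S) *v \<psi> t)) (at t)" for t
      unfolding \<psi>_def by (rule adjoint_flow_deriv)
    have dq: "((\<lambda>t. - q (\<psi> t)) has_real_derivative (- 2 * ((transpose (sysA S) *v \<psi> t) \<bullet> (P *v \<psi> t)))) (at t)" for t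
    proof -
      have 1: "((\<lambda>t. P *v \<psi> t) has_vector_derivative (P *v (transpose (sysA S) *v \<psi> t))) (at t)"
        by (rule bounded_linear.has_vector_derivative[OF matrix_vector_mul_bounded_linear d\<psi>])
      have "((\<lambda>t. \<psi> t \<bullet> (P *v \<psi> t)) has_vector_derivative
          (\<psi> t \<bullet> (P *v (transpose (sysA S) *v \<psi> t)) + (transpose (sysA S) *v \<psi> t) \<bullet> (P *v \<psi> t))) (at t)"
        by (rule bounded_bilinear.has_vector_derivative[OF bounded_bilinear_inner d\<psi> 1])
      then have "((\<lambda>t. q (\<psi> t)) has_real_derivative 2 * ((transpose (sysA S) *v \<psi> t) \<bullet> (P *v \<psi> t))) (at t)"
        unfolding has_real_derivative_iff_has_vector_derivative q_def
        using sym[of "\<psi> t" "transpose (sysA S) *v \<psi> t"] by simp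
      then show ?thesis using DERIV_minus by fastforce
    qed
    have bound: "(\<integral>\<^sup>+ \<tau>. ennreal (g (\<psi> \<tau>)) * indicator {0..real n} \<tau> \<partial>lborel) \<le> ennreal (q w)" for n
    proof -
      have gd: "g (\<psi> \<tau>) \<le> - 2 * ((transpose (sysA S) *v \<psi> \<tau>) \<bullet> (P *v \<psi> \<tau>))" for \<tau>
        using diss[of "\<psi> \<tau>"] by (simp add: g_def q_def)
      have "(\<integral>\<^sup>+ \<tau>. ennreal (g (\<psi> \<tau>)) * indicator {0..real n} \<tau> \<partial>lborel) \<le>
          (\<integral>\<^sup>+ \<tau>. ennreal (- 2 * ((transpose (sysA S) *v \<psi> \<tau>) \<bullet> (P *v \<psi> \<tau>))) * indicator {0..real n} \<tau> \<partial>lborel)"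
        by (intro nn_integral_mono mult_right_mono ennreal_leI gd) simp
      also have "\<dots> = ennreal (- q (\<psi> (real n)) - (- q (\<psi> 0)))"
      proof (rule nn_integral_FTC_Icc[where F = "\<lambda>t. - q (\<psi> t)"])
        show "(\<lambda>\<tau>. - 2 * ((transpose (sysA S) *v \<psi> \<tau>) \<bullet> (P *v \<psi> \<tau>))) \<in> borel_measurable borel"
          unfolding \<psi>_def by measurable
        show "((\<lambda>t. - q (\<psi> t)) has_real_derivative - 2 * ((transpose (sysA S) *v \<psi> \<tau>) \<bullet> (P *v \<psi> \<tau>))) (at \<tau>)" for \<tau>
          by (rule dq)
        show "0 \<le> - 2 * ((transpose (sysA S) *v \<psi> \<tau>) \<bullet> (P *v \<psi> \<tau>))" for \<tau>
          using gd[of \<tau>] g[of "\<psi> \<tau>"] by linarith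
      qed simp
      also have "\<dots> \<le> ennreal (q w)"
        using q[of "\<psi> (real n)"] by (intro ennreal_leI) (simp add: \<psi>_def)
      finally show ?thesis .
    qed
    have sup: "ennreal (g (\<psi> \<tau>)) * indicator {0..} \<tau> = (SUP n. ennreal (g (\<psi> \<tau>)) * indicator {0..real n} \<tau>)" for \<tau>
    proof (rule antisym)
      obtain n where "\<tau> \<le> real n" using real_arch_simple by blast
      then have "ennreal (g (\<psi> \<tau>)) * indicator {0..} \<tau> \<le> ennreal (g (\<psi> \<tau>)) * indicator {0..real n} \<tau>"
        by (auto simp: indicator_def)
      then show "ennreal (g (\<psi> \<tau>)) * indicator {0..} \<tau> \<le> (SUP n. ennreal (g (\<psi> \<tau>)) * indicator {0..real n} \<tau>)"
        by (rule SUP_upper2[OF UNIV_I])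
    qed (auto intro!: SUP_least simp: indicator_def)
    have "(\<integral>\<^sup>+ \<tau> \<in> {0..}. ennreal (g (\<psi> \<tau>)) \<partial>lborel) =
        (SUP n. \<integral>\<^sup>+ \<tau>. ennreal (g (\<psi> \<tau>)) * indicator {0..real n} \<tau> \<partial>lborel)"
      unfolding sup by (intro nn_integral_monotone_convergence_SUP)
        (auto simp: incseq_def le_fun_def indicator_def)
    also have "\<dots> \<le> ennreal (q w)" by (intro SUP_least bound)
    finally show ?thesis by (simp add: \<psi>_def)
  qed
  have "(\<Sum>i<n. kernel_energy S (Suc i) w) \<le> ennreal (q w)" for n
  proof (induction n arbitrary: w)
    case (Suc n)
    have "(\<Sum>i<Suc n. kernel_energy S (Suc i) w) =
        kernel_energy S (Suc 0) w + (\<Sum>i<n. kernel_energy S (Suc (Suc i)) w)"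
      by (rule sum.lessThan_Suc_shift)
    also have "\<dots> = (\<integral>\<^sup>+ \<tau> \<in> {0..}. (ennreal ((norm (transpose (sysB S) *v adjoint_flow (sysA S) w \<tau>))\<^sup>2) +
        (\<Sum>k\<in>UNIV. \<Sum>i<n. kernel_energy S (Suc i) (transpose (sysN S k) *v adjoint_flow (sysA S) w \<tau>))) \<partial>lborel)"
      unfolding kernel_energy_1 kernel_energy_Suc
      by (subst nn_integral_sum[symmetric], measurable, subst nn_integral_add[symmetric], measurable)
        (subst sum.swap, simp add: distrib_right sum_distrib_right)
    also have "\<dots> \<le> (\<integral>\<^sup>+ \<tau> \<in> {0..}. ennreal (g (adjoint_flow (sysA S) w \<tau>)) \<partial>lborel)"
    proof (intro nn_integral_mono mult_right_mono)
      fix \<tau> :: real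
      have "(\<Sum>k\<in>UNIV. \<Sum>i<n. kernel_energy S (Suc i) (transpose (sysN S k) *v adjoint_flow (sysA S) w \<tau>))
        \<le> (\<Sum>k\<in>UNIV. ennreal (q (transpose (sysN S k) *v adjoint_flow (sysA S) w \<tau>)))"
        by (intro sum_mono Suc.IH)
      also have "\<dots> = ennreal (\<Sum>k\<in>UNIV. q (transpose (sysN S k) *v adjoint_flow (sysA S) w \<tau>))"
        by (intro sum_ennreal q)
      finally show "ennreal ((norm (transpose (sysB S) *v adjoint_flow (sysA S) w \<tau>))\<^sup>2) +
        (\<Sum>k\<in>UNIV. \<Sum>i<n. kernel_energy S (Suc i) (transpose (sysN S k) *v adjoint_flow (sysA S) w \<tau>))
        \<le> ennreal (g (adjoint_flow (sysA S) w \<tau>))"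
        unfolding g_def by (subst ennreal_plus) (auto intro!: add_left_mono sum_nonneg q)
    qed simp
    also have "\<dots> \<le> ennreal (q w)" by (rule flow)
    finally show ?case .
  qed simp
  then show ?thesis
    unfolding total_energy_def q_def[symmetric] by (intro suminf_le_const) auto
qed

section \<open>Trajectories are dominated by the energy\<close>

lemma nn_integral_lebesgue_on_Icc:
  fixes f :: "real \<Rightarrow> real"
  assumes f: "f absolutely_integrable_on {a..b}" and nonneg: "\<And>s. s \<in> {a..b} \<Longrightarrow> 0 \<le> f s"
  shows "(\<integral>\<^sup>+ s. ennreal (f s) \<partial>lebesgue_on {a..b}) = ennreal (integral {a..b} f)"
proof -
  have "integrable (lebesgue_on {a..b}) f"
    using f by (rule absolutely_integrable_imp_integrable) simp
  then show ?thesis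
    by (subst nn_integral_eq_integral)
      (auto intro!: AE_I2 nonneg simp: lebesgue_integral_eq_integral)
qed

lemma ennreal_le_if_square_le:
  assumes "x\<^sup>2 \<le> (ennreal s)\<^sup>2" "0 \<le> s"
  shows "x \<le> ennreal s"
proof (cases x)
  case (real r)
  then show ?thesis
    using assms by (auto simp: ennreal_power intro!: ennreal_leI power2_le_imp_le)
next
  case top
  then show ?thesis
    using assms by (simp add: ennreal_power power2_eq_square[of "top :: ennreal"] top_unique ennreal_top_mult)
qed

lemma nn_integral_sqrt_mult_le:
  assumes [measurable]: "\<alpha> \<in> borel_measurable M" "\<beta> \<in> borel_measurable M"
    and nonneg: "\<And>s. s \<in> space M \<Longrightarrow> 0 \<le> \<alpha> s" "\<And>s. s \<in> space M \<Longrightarrow> 0 \<le> \<beta> s"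
    and \<alpha>: "(\<integral>\<^sup>+ s. ennreal (\<alpha> s) \<partial>M) \<le> ennreal a" and \<beta>: "(\<integral>\<^sup>+ s. ennreal (\<beta> s) \<partial>M) \<le> ennreal b"
    and ab: "0 \<le> a" "0 \<le> b"
  shows "(\<integral>\<^sup>+ s. ennreal (sqrt (\<alpha> s) * sqrt (\<beta> s)) \<partial>M) \<le> ennreal (sqrt (a * b))"
proof -
  have "(\<integral>\<^sup>+ s. ennreal (sqrt (\<alpha> s) * sqrt (\<beta> s)) \<partial>M)\<^sup>2
      = (\<integral>\<^sup>+ s. ennreal (sqrt (\<alpha> s)) * ennreal (sqrt (\<beta> s)) \<partial>M)\<^sup>2"
    by (intro arg_cong[where f = "\<lambda>x. x\<^sup>2"] nn_integral_cong) (simp add: ennreal_mult nonneg)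
  also have "\<dots> \<le> (\<integral>\<^sup>+ s. (ennreal (sqrt (\<alpha> s)))\<^sup>2 \<partial>M) * (\<integral>\<^sup>+ s. (ennreal (sqrt (\<beta> s)))\<^sup>2 \<partial>M)"
    by (rule Cauchy_Schwarz_nn_integral) measurable
  also have "(\<integral>\<^sup>+ s. (ennreal (sqrt (\<alpha> s)))\<^sup>2 \<partial>M) = (\<integral>\<^sup>+ s. ennreal (\<alpha> s) \<partial>M)"
    by (intro nn_integral_cong) (simp add: ennreal_power nonneg)
  also have "(\<integral>\<^sup>+ s. (ennreal (sqrt (\<beta> s)))\<^sup>2 \<partial>M) = (\<integral>\<^sup>+ s. ennreal (\<beta> s) \<partial>M)"
    by (intro nn_integral_cong) (simp add: ennreal_power nonneg)
  also have "(\<integral>\<^sup>+ s. ennreal (\<alpha> s) \<partial>M) * (\<integral>\<^sup>+ s. ennreal (\<beta> s) \<partial>M) \<le> ennreal a * ennreal b"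
    by (intro mult_mono \<alpha> \<beta>) auto
  also have "\<dots> = (ennreal (sqrt (a * b)))\<^sup>2"
    using ab by (simp add: ennreal_power ennreal_mult)
  finally show ?thesis
    by (rule ennreal_le_if_square_le) (use ab in simp)
qed

lemma two_term_Cauchy_Schwarz:
  fixes p r a b :: real
  assumes "0 \<le> p" "0 \<le> r" "0 \<le> a" "0 \<le> b"
  shows "p * r + a * b \<le> sqrt (p\<^sup>2 + a\<^sup>2) * sqrt (r\<^sup>2 + b\<^sup>2)"
proof -
  have "(p * r + a * b)\<^sup>2 + (p * b - a * r)\<^sup>2 = (p\<^sup>2 + a\<^sup>2) * (r\<^sup>2 + b\<^sup>2)"
    by (simp add: power2_eq_square algebra_simps)
  then have "(p * r + a * b)\<^sup>2 \<le> (p\<^sup>2 + a\<^sup>2) * (r\<^sup>2 + b\<^sup>2)"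
    by (metis add_le_cancel_left le_add_same_cancel1 zero_le_power2)
  then show ?thesis
    unfolding real_sqrt_mult[symmetric] by (rule real_le_rsqrt)
qed

text \<open>
The input may be replaced by \<open>u\<^sup>0\<close> in the bilinear term: the components that this sets to zero
multiply zero matrices.
\<close>

lemma bqo_rhs_split:
  "bqo_rhs S w z \<bullet> v - (sysA S *v z) \<bullet> v =
    (\<Sum>k\<in>UNIV. input0 S (\<lambda>_. w) s $ k * ((transpose (sysN S k) *v v) \<bullet> z)) + (transpose (sysB S) *v v) \<bullet> w"
proof -
  have "(\<Sum>k\<in>UNIV. (w $ k) *\<^sub>R (sysN S k *v z)) \<bullet> v
      = (\<Sum>k\<in>UNIV. input0 S (\<lambda>_. w) s $ k * ((transpose (sysN S k) *v v) \<bullet> z))"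
    unfolding inner_sum_left
  proof (intro sum.cong refl)
    fix k
    have "(sysN S k *v z) \<bullet> v = (transpose (sysN S k) *v v) \<bullet> z"
      by (metis inner_commute inner_transpose)
    then show "((w $ k) *\<^sub>R (sysN S k *v z)) \<bullet> v
        = input0 S (\<lambda>_. w) s $ k * ((transpose (sysN S k) *v v) \<bullet> z)"
      by (cases "sysN S k = 0") (auto simp: input0_def)
  qed
  moreover have "(sysB S *v w) \<bullet> v = (transpose (sysB S) *v v) \<bullet> w"
    by (simp add: inner_commute[of _ v] dot_lmul_matrix)
  ultimately show ?thesis
    by (simp add: bqo_rhs_def inner_add_left)
qed

text \<open>
Integration by parts of \<open>\<psi>(t - s) \<bullet> x(s)\<close>, in which the contributions of \<open>A\<close> cancel.
\<close>

lemma variation_of_constants: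
  fixes S :: "('n::finite, 'm::finite, 'p::finite) bqo" and w :: "real ^ 'n"
  assumes traj: "bqo_trajectory S u x" and t: "0 \<le> t"
  defines "h \<equiv> \<lambda>s. (\<Sum>k\<in>UNIV. input0 S u s $ k *
      ((transpose (sysN S k) *v adjoint_flow (sysA S) w (t - s)) \<bullet> x s)) +
      (transpose (sysB S) *v adjoint_flow (sysA S) w (t - s)) \<bullet> u s"
  shows "h absolutely_integrable_on {0..t}" and "w \<bullet> x t = integral {0..t} h"
proof -
  define v where "v s = bqo_rhs S (u s) (x s)" for s
  define \<psi> where "\<psi> s = adjoint_flow (sysA S) w (t - s)" for s
  have v: "v absolutely_integrable_on {0..t}" and x: "x s = integral {0..s} v" if "0 \<le> s" for s
    using traj t that by (auto simp: bqo_trajectory_def v_def[abs_def])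
  have d: "(\<psi> has_vector_derivative - (transpose (sysA S) *v \<psi> s)) (at s within {0..t})" for s
  proof -
    have "((\<lambda>s. t - s) has_vector_derivative - 1) (at s within {0..t})"
      by (auto intro!: derivative_eq_intros)
    from vector_diff_chain_within[OF this adjoint_flow_deriv]
    show ?thesis by (simp add: \<psi>_def[abs_def] o_def)
  qed
  have c: "continuous_on {0..t} (\<lambda>s. - (transpose (sysA S) *v \<psi> s))"
    by (intro continuous_on_minus continuous_on_compose2[OF matrix_vector_mult_linear_continuous_on[of UNIV]]
        continuous_on_vector_derivative[OF d]) auto
  note parts = integral_by_parts_absolutely_continuous[OF t v[OF t] d c]
  have eq: "integral {0..s} v \<bullet> - (transpose (sysA S) *v \<psi> s) + v s \<bullet> \<psi> s = h s" if "s \<in> {0..t}" for s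
  proof -
    have "(sysA S *v x s) \<bullet> \<psi> s = x s \<bullet> (transpose (sysA S) *v \<psi> s)"
      by (metis inner_commute inner_transpose)
    moreover have "v s \<bullet> \<psi> s - (sysA S *v x s) \<bullet> \<psi> s = h s"
      unfolding h_def v_def \<psi>_def using bqo_rhs_split[of S "u s" "x s" _ s] by (simp add: input0_def)
    ultimately show ?thesis using that by (simp flip: x)
  qed
  show "h absolutely_integrable_on {0..t}"
    by (rule absolutely_integrable_spike[OF parts(1), of "{}"]) (simp, simp only: Diff_empty eq)
  have "integral {0..t} h = x t \<bullet> \<psi> t"
    using parts(2) t x[OF t] by (subst integral_cong[OF eq[symmetric]]) auto
  then show "w \<bullet> x t = integral {0..t} h"
    by (simp add: \<psi>_def inner_commute)
qed

lemma L2_input_absolutely_integrable: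
  assumes "L2_input u"
  shows "(\<lambda>s. (norm (u s))\<^sup>2) absolutely_integrable_on {0..}"
    and "L2_norm_sq u = integral {0..} (\<lambda>s. (norm (u s))\<^sup>2)"
  using assms
  by (simp_all add: L2_input_def L2_norm_sq_def set_integrable_def integrable_restrict_space
      lebesgue_integral_eq_integral)

lemma L2_norm_sq_nonneg: "0 \<le> L2_norm_sq u"
  unfolding L2_norm_sq_def by (rule Bochner_Integration.integral_nonneg) simp

lemma L2_input_on_Icc:
  fixes u :: "real \<Rightarrow> real ^ 'm::finite"
  assumes u: "L2_input u"
  shows "(\<lambda>s. (norm (u s))\<^sup>2) absolutely_integrable_on {0..t}"
    and "integral {0..t} (\<lambda>s. (norm (u s))\<^sup>2) \<le> L2_norm_sq u"
    and "(\<lambda>s. norm (u s)) absolutely_integrable_on {0..t}"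
    and "u \<in> borel_measurable (lebesgue_on {0..t})"
proof -
  note L2 = L2_input_absolutely_integrable[OF u]
  show sq: "(\<lambda>s. (norm (u s))\<^sup>2) absolutely_integrable_on {0..t}"
    by (rule absolutely_integrable_on_subinterval[OF L2(1)]) auto
  show "integral {0..t} (\<lambda>s. (norm (u s))\<^sup>2) \<le> L2_norm_sq u"
    unfolding L2(2) using sq L2(1)
    by (intro integral_subset_le) (auto simp: absolutely_integrable_on_def)
  show m: "u \<in> borel_measurable (lebesgue_on {0..t})"
    by (rule measurable_restrict_mono[of _ _ "{0..}"]) (use u in \<open>auto simp: L2_input_def\<close>)
  show "(\<lambda>s. norm (u s)) absolutely_integrable_on {0..t}"
  proof (rule measurable_bounded_by_integrable_imp_absolutely_integrable)
    show "(\<lambda>s. norm (u s)) \<in> borel_measurable (lebesgue_on {0..t})"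
      using m by measurable
    show "(\<lambda>s. 1 + (norm (u s))\<^sup>2) integrable_on {0..t}"
      using sq by (intro integrable_add) (auto simp: absolutely_integrable_on_def)
    show "norm (norm (u s)) \<le> 1 + (norm (u s))\<^sup>2" for s
      using sum_power2_ge_zero[of "norm (u s) - 1/2" 0] by (simp add: power2_eq_square algebra_simps)
  qed auto
qed

lemma norm_input0_le: "norm (input0 S u s) \<le> norm (u s)"
  by (rule norm_le_componentwise_cart) (simp add: input0_def)

lemma L2_input_input0:
  assumes u: "L2_input u"
  shows "L2_input (input0 S u)"
proof -
  have "(\<lambda>v. input0 S (\<lambda>_. v) 0) \<in> borel_measurable borel"
    unfolding input0_def
  proof (intro borel_measurable_continuous_onI continuous_on_vec_lambda)
    show "continuous_on UNIV (\<lambda>v. if sysN S k = 0 then 0 else v $ k)" for k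
      by (cases "sysN S k = 0") (auto intro!: continuous_intros)
  qed
  from measurable_compose[OF _ this]
  have m: "input0 S u \<in> borel_measurable (lebesgue_on {0..})"
    using u by (auto simp: L2_input_def input0_def[abs_def])
  moreover have "integrable (lebesgue_on {0..}) (\<lambda>s. (norm (input0 S u s))\<^sup>2)"
  proof (rule Bochner_Integration.integrable_bound)
    show "integrable (lebesgue_on {0..}) (\<lambda>s. (norm (u s))\<^sup>2)"
      using u by (simp add: L2_input_def)
    show "(\<lambda>s. (norm (input0 S u s))\<^sup>2) \<in> borel_measurable (lebesgue_on {0..})"
      using m by measurable
  qed (auto intro!: power_mono norm_input0_le)
  ultimately show ?thesis by (simp add: L2_input_def)
qed

text \<open>
The convolution in the variation of constants formula runs backwards in time on a bounded interval.
\<close>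

lemma nn_integral_reverse_le:
  fixes f :: "real \<Rightarrow> ennreal"
  assumes [measurable]: "f \<in> borel_measurable borel"
  shows "(\<integral>\<^sup>+ s. f (t - s) \<partial>lebesgue_on {0..t}) \<le> (\<integral>\<^sup>+ \<tau> \<in> {0..}. f \<tau> \<partial>lborel)"
proof -
  have "(\<integral>\<^sup>+ s. f (t - s) \<partial>lebesgue_on {0..t}) = (\<integral>\<^sup>+ s. f (t - s) * indicator {0..t} s \<partial>lborel)"
    by (subst nn_integral_restrict_space) (auto simp: nn_integral_completion)
  also have "\<dots> \<le> (\<integral>\<^sup>+ s. f (t + (-1) * s) * indicator {0..} (t + (-1) * s) \<partial>lborel)"
    by (intro nn_integral_mono) (auto simp: indicator_def)
  also have "\<dots> = (\<integral>\<^sup>+ \<tau> \<in> {0..}. f \<tau> \<partial>lborel)"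
    using nn_integral_real_affine[of "\<lambda>\<tau>. f \<tau> * indicator {0..} \<tau>" "-1" t] by simp
  finally show ?thesis .
qed

text \<open>
One repetition of the argument for \<open>(w \<bullet> x(t))\<^sup>2 \<le> c(t) \<E>(w)\<close>. The main term is reproduced exactly: \<open>\<E>\<close>
solves its integral equation (\<open>total_energy_eq\<close>) and \<open>c\<close> satisfies \<open>\<integral>\<^sub>0\<^sup>t |u|\<^sup>2 + |u\<^sup>0|\<^sup>2 c \<le> c(t)\<close>. The error term passes
through the integral operator with kernel \<open>K |u\<^sup>0|\<close>, which in the norm weighted with
\<open>exp (2 K \<integral> |u\<^sup>0|)\<close> is a contraction with factor \<open>1/2\<close>. An error term is needed to start with, since
\<open>\<E>\<close> may vanish in some directions.
\<close>

lemma sqrt_energy_bound_improve: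
  fixes S :: "('n::finite, 'm::finite, 'p::finite) bqo"
  assumes u: "L2_input u" and traj: "bqo_trajectory S u x"
    and e: "\<And>w. total_energy S w = ennreal (e w)" "\<And>w. 0 \<le> e w"
    and t: "0 \<le> t" and K: "K > 0" and q: "0 \<le> q"
    and K': "\<And>\<tau> w. \<tau> \<in> {0..t} \<Longrightarrow> 
      L2_set (\<lambda>k. norm (transpose (sysN S k) *v adjoint_flow (sysA S) w \<tau>)) UNIV \<le> K * norm w"
  defines "c \<equiv> \<lambda>s. L2_norm_sq u * exp (integral {0..s} (\<lambda>r. (norm (input0 S u r))\<^sup>2))"
    and "V \<equiv> \<lambda>s. integral {0..s} (\<lambda>r. 2 * K * norm (input0 S u r))"
  assumes bound: "\<And>s w. s \<in> {0..t} \<Longrightarrow> \<bar>w \<bullet> x s\<bar> \<le> sqrt (e w * c s) + q * exp (V s) * norm w"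
  shows "\<bar>w \<bullet> x t\<bar> \<le> sqrt (e w * c t) + q / 2 * exp (V t) * norm w"
proof -
  define u0 where "u0 = input0 S u"
  have u0: "L2_input u0" unfolding u0_def by (rule L2_input_input0[OF u])
  define \<psi> where "\<psi> s = adjoint_flow (sysA S) w (t - s)" for s
  define \<nu> where "\<nu> k s = transpose (sysN S k) *v \<psi> s" for k s
  \<comment> \<open>The integrand \<open>h\<close> of the variation of constants formula is bounded by \<open>sqrt \<alpha> sqrt \<beta>\<close>, where \<open>\<alpha>\<close> depends
    on the system and integrates to at most \<open>\<E>(w)\<close>, and \<open>\<beta>\<close> depends on the input and integrates to at
    most \<open>c(t)\<close>, plus a multiple of \<open>\<gamma>\<close>, which is almost everywhere the derivative of the weight \<open>exp (V s)\<close>.\<close>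
  define \<alpha> where "\<alpha> s = (norm (transpose (sysB S) *v \<psi> s))\<^sup>2 + (\<Sum>k\<in>UNIV. e (\<nu> k s))" for s
  define \<beta> where "\<beta> s = (norm (u s))\<^sup>2 + (norm (u0 s))\<^sup>2 * c s" for s
  define \<gamma> where "\<gamma> s = 2 * K * norm (u0 s) * exp (V s)" for s
  define h where "h s = (\<Sum>k\<in>UNIV. u0 s $ k * (\<nu> k s \<bullet> x s)) + (transpose (sysB S) *v \<psi> s) \<bullet> u s" for s
  have h: "h absolutely_integrable_on {0..t}" and wx: "w \<bullet> x t = integral {0..t} h"
    using variation_of_constants[OF traj t, of w]
    by (simp_all add: h_def[abs_def] u0_def \<nu>_def \<psi>_def)
  have c: "c s \<ge> 0" for s by (simp add: c_def L2_norm_sq_nonneg)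
  have \<alpha>0: "0 \<le> \<alpha> s" for s by (simp add: \<alpha>_def e sum_nonneg)
  have \<beta>0: "0 \<le> \<beta> s" for s by (simp add: \<beta>_def c)
  have \<gamma>0: "0 \<le> \<gamma> s" for s using K by (simp add: \<gamma>_def)
  have pointwise: "\<bar>h s\<bar> \<le> sqrt (\<alpha> s) * sqrt (\<beta> s) + q / 2 * norm w * \<gamma> s" if s: "s \<in> {0..t}" for s
  proof -
    have nu: "L2_set (\<lambda>k. \<bar>u0 s $ k\<bar>) UNIV = norm (u0 s)"
      by (simp add: norm_vec_def L2_set_def)
    have "\<bar>h s\<bar> \<le> \<bar>\<Sum>k\<in>UNIV. u0 s $ k * (\<nu> k s \<bullet> x s)\<bar> + norm (transpose (sysB S) *v \<psi> s) * norm (u s)"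
      unfolding h_def by (rule order_trans[OF abs_triangle_ineq add_left_mono[OF Cauchy_Schwarz_ineq2]])
    also have "\<bar>\<Sum>k\<in>UNIV. u0 s $ k * (\<nu> k s \<bullet> x s)\<bar> \<le> (\<Sum>k\<in>UNIV. \<bar>u0 s $ k\<bar> * \<bar>\<nu> k s \<bullet> x s\<bar>)"
      unfolding abs_mult[symmetric] by (rule sum_abs)
    also have "\<dots> \<le> (\<Sum>k\<in>UNIV. \<bar>u0 s $ k\<bar> * (sqrt (e (\<nu> k s)) * sqrt (c s) + q * exp (V s) * norm (\<nu> k s)))"
      using bound[OF s] by (intro sum_mono mult_left_mono) (auto simp: real_sqrt_mult)
    also have "\<dots> = (\<Sum>k\<in>UNIV. \<bar>u0 s $ k\<bar> * sqrt (e (\<nu> k s))) * sqrt (c s)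
        + q * exp (V s) * (\<Sum>k\<in>UNIV. \<bar>u0 s $ k\<bar> * norm (\<nu> k s))"
      by (simp add: sum_distrib_left sum_distrib_right sum.distrib[symmetric] algebra_simps)
    also have "(\<Sum>k\<in>UNIV. \<bar>u0 s $ k\<bar> * sqrt (e (\<nu> k s))) \<le> norm (u0 s) * sqrt (\<Sum>k\<in>UNIV. e (\<nu> k s))"
      using L2_set_mult_ineq[of "\<lambda>k. \<bar>u0 s $ k\<bar>" "\<lambda>k. sqrt (e (\<nu> k s))" UNIV] nu e
      by (simp add: L2_set_def)
    also have "(\<Sum>k\<in>UNIV. \<bar>u0 s $ k\<bar> * norm (\<nu> k s)) \<le> norm (u0 s) * (K * norm w)"
    proof -
      have "(\<Sum>k\<in>UNIV. \<bar>u0 s $ k\<bar> * norm (\<nu> k s)) \<le> norm (u0 s) * L2_set (\<lambda>k. norm (\<nu> k s)) UNIV"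
        using L2_set_mult_ineq[of "\<lambda>k. \<bar>u0 s $ k\<bar>" "\<lambda>k. norm (\<nu> k s)" UNIV] nu by simp
      also have "\<dots> \<le> norm (u0 s) * (K * norm w)"
        using K'[of "t - s" w] s by (intro mult_left_mono) (auto simp: \<nu>_def \<psi>_def)
      finally show ?thesis .
    qed
    finally have "\<bar>h s\<bar> \<le> norm (u0 s) * sqrt (\<Sum>k\<in>UNIV. e (\<nu> k s)) * sqrt (c s)
        + q * exp (V s) * (norm (u0 s) * (K * norm w)) + norm (transpose (sysB S) *v \<psi> s) * norm (u s)"
      using q c by (simp add: mult_left_mono mult_right_mono)
    moreover have "norm (transpose (sysB S) *v \<psi> s) * norm (u s)
        + sqrt (\<Sum>k\<in>UNIV. e (\<nu> k s)) * (norm (u0 s) * sqrt (c s)) \<le> sqrt (\<alpha> s) * sqrt (\<beta> s)"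
      using two_term_Cauchy_Schwarz[of "norm (transpose (sysB S) *v \<psi> s)" "norm (u s)"
          "sqrt (\<Sum>k\<in>UNIV. e (\<nu> k s))" "norm (u0 s) * sqrt (c s)"] c e
      by (simp add: \<alpha>_def \<beta>_def power_mult_distrib sum_nonneg)
    ultimately show ?thesis by (simp add: \<gamma>_def algebra_simps)
  qed
  have m1 [measurable]: "\<alpha> \<in> borel_measurable (lebesgue_on {0..t})"
  proof -
    have "(\<lambda>s. enn2real (ennreal ((norm (transpose (sysB S) *v adjoint_flow (sysA S) w (t - s)))\<^sup>2) +
       (\<Sum>k\<in>UNIV. total_energy S (transpose (sysN S k) *v adjoint_flow (sysA S) w (t - s))))) \<in> borel_measurable borel"
      by measurable
    moreover have "ennreal ((norm (transpose (sysB S) *v \<psi> s))\<^sup>2) + (\<Sum>k\<in>UNIV. total_energy S (\<nu> k s)) = ennreal (\<alpha> s)" for s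
      unfolding e(1) \<alpha>_def by (subst sum_ennreal) (auto simp: e(2) sum_nonneg)
    ultimately have "\<alpha> \<in> borel_measurable borel"
      by (simp add: \<nu>_def \<psi>_def \<alpha>0)
    then show ?thesis
      by (intro measurable_restrict_space1 measurable_completion) simp
  qed
  have \<alpha>: "(\<integral>\<^sup>+ s. ennreal (\<alpha> s) \<partial>lebesgue_on {0..t}) \<le> ennreal (e w)"
  proof -
    let ?f = "\<lambda>\<tau>. ennreal ((norm (transpose (sysB S) *v adjoint_flow (sysA S) w \<tau>))\<^sup>2) +
       (\<Sum>k\<in>UNIV. total_energy S (transpose (sysN S k) *v adjoint_flow (sysA S) w \<tau>))"
    have "(\<integral>\<^sup>+ s. ennreal (\<alpha> s) \<partial>lebesgue_on {0..t}) = (\<integral>\<^sup>+ s. ?f (t - s) \<partial>lebesgue_on {0..t})"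
      unfolding e(1) \<alpha>_def \<nu>_def \<psi>_def by (intro nn_integral_cong, subst sum_ennreal) (auto simp: e(2) sum_nonneg)
    also have "\<dots> \<le> (\<integral>\<^sup>+ \<tau> \<in> {0..}. ?f \<tau> \<partial>lborel)"
      by (rule nn_integral_reverse_le) measurable
    also have "\<dots> = ennreal (e w)"
      unfolding e(1)[of w, symmetric] by (rule total_energy_eq[symmetric])
    finally show ?thesis .
  qed
  have e2: "(\<lambda>s. (norm (u0 s))\<^sup>2 * c s) absolutely_integrable_on {0..t}"
    "integral {0..t} (\<lambda>s. (norm (u0 s))\<^sup>2 * c s) \<le> c t - L2_norm_sq u"
  proof -
    note E = integral_times_exp_primitive_le[OF t L2_input_on_Icc(1)[OF u0]]
    have eq: "(\<lambda>s. (norm (u0 s))\<^sup>2 * c s)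
       = (\<lambda>s. L2_norm_sq u * ((norm (u0 s))\<^sup>2 * exp (integral {0..s} (\<lambda>r. (norm (u0 r))\<^sup>2))))"
      by (simp add: c_def u0_def fun_eq_iff)
    show "(\<lambda>s. (norm (u0 s))\<^sup>2 * c s) absolutely_integrable_on {0..t}"
      unfolding eq using E(1) by (intro set_integrable_mult_right) simp
    show "integral {0..t} (\<lambda>s. (norm (u0 s))\<^sup>2 * c s) \<le> c t - L2_norm_sq u"
      unfolding eq using mult_left_mono[OF E(2) L2_norm_sq_nonneg[of u]]
      by (simp add: c_def u0_def algebra_simps)
  qed
  have abs\<beta>: "\<beta> absolutely_integrable_on {0..t}"
    unfolding \<beta>_def[abs_def] by (intro set_integral_add L2_input_on_Icc(1)[OF u] e2(1))
  have \<beta>: "(\<integral>\<^sup>+ s. ennreal (\<beta> s) \<partial>lebesgue_on {0..t}) \<le> ennreal (c t)"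
  proof -
    have "integral {0..t} \<beta> = integral {0..t} (\<lambda>s. (norm (u s))\<^sup>2) + integral {0..t} (\<lambda>s. (norm (u0 s))\<^sup>2 * c s)"
      unfolding \<beta>_def[abs_def] using L2_input_on_Icc(1)[OF u] e2(1)
      by (intro Henstock_Kurzweil_Integration.integral_add) (auto simp: absolutely_integrable_on_def)
    also have "\<dots> \<le> c t" using L2_input_on_Icc(2)[OF u, of t] e2(2) by simp
    finally show ?thesis
      by (subst nn_integral_lebesgue_on_Icc[OF abs\<beta>]) (auto simp: \<beta>0 intro: ennreal_leI)
  qed
  have \<gamma>: "\<gamma> absolutely_integrable_on {0..t}" "integral {0..t} \<gamma> \<le> exp (V t)"
  proof -
    have f: "(\<lambda>s. 2 * K * norm (u0 s)) absolutely_integrable_on {0..t}"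
      using L2_input_on_Icc(3)[OF u0] by (intro set_integrable_mult_right) simp
    note E = integral_times_exp_primitive_le[OF t f]
    show "\<gamma> absolutely_integrable_on {0..t}"
      using E(1) K by (simp add: \<gamma>_def[abs_def] V_def u0_def)
    show "integral {0..t} \<gamma> \<le> exp (V t)"
      using E(2) K by (simp add: \<gamma>_def[abs_def] V_def u0_def)
  qed
  have m2 [measurable]: "\<beta> \<in> borel_measurable (lebesgue_on {0..t})"
    using absolutely_integrable_imp_integrable[OF abs\<beta>] by simp
  have m3 [measurable]: "\<gamma> \<in> borel_measurable (lebesgue_on {0..t})"
    using absolutely_integrable_imp_integrable[OF \<gamma>(1)] by simp
  have "ennreal \<bar>w \<bullet> x t\<bar> \<le> ennreal (integral {0..t} (\<lambda>s. \<bar>h s\<bar>))"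
    unfolding wx using integral_norm_bound_integral[of h "{0..t}" "\<lambda>s. \<bar>h s\<bar>"] h
    by (intro ennreal_leI) (auto simp: absolutely_integrable_on_def)
  also have "\<dots> = (\<integral>\<^sup>+ s. ennreal \<bar>h s\<bar> \<partial>lebesgue_on {0..t})"
    using h by (intro nn_integral_lebesgue_on_Icc[symmetric]) (auto simp: absolutely_integrable_on_def)
  also have "\<dots> \<le> (\<integral>\<^sup>+ s. (ennreal (sqrt (\<alpha> s) * sqrt (\<beta> s)) + ennreal (q / 2 * norm w * \<gamma> s)) \<partial>lebesgue_on {0..t})"
  proof (intro nn_integral_mono)
    fix s assume "s \<in> space (lebesgue_on {0..t})"
    then have "ennreal \<bar>h s\<bar> \<le> ennreal (sqrt (\<alpha> s) * sqrt (\<beta> s) + q / 2 * norm w * \<gamma> s)"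
      by (intro ennreal_leI pointwise) simp
    also have "\<dots> = ennreal (sqrt (\<alpha> s) * sqrt (\<beta> s)) + ennreal (q / 2 * norm w * \<gamma> s)"
      using q by (intro ennreal_plus) (auto simp: \<alpha>0 \<beta>0 \<gamma>0)
    finally show "ennreal \<bar>h s\<bar> \<le> ennreal (sqrt (\<alpha> s) * sqrt (\<beta> s)) + ennreal (q / 2 * norm w * \<gamma> s)" .
  qed
  also have "\<dots> = (\<integral>\<^sup>+ s. ennreal (sqrt (\<alpha> s) * sqrt (\<beta> s)) \<partial>lebesgue_on {0..t}) + (\<integral>\<^sup>+ s. ennreal (q / 2 * norm w * \<gamma> s) \<partial>lebesgue_on {0..t})"
    by (intro nn_integral_add) measurable
  also have "(\<integral>\<^sup>+ s. ennreal (sqrt (\<alpha> s) * sqrt (\<beta> s)) \<partial>lebesgue_on {0..t}) \<le> ennreal (sqrt (e w * c t))"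
    by (intro nn_integral_sqrt_mult_le m1 m2 \<alpha> \<beta> \<alpha>0 \<beta>0 e(2) c)
  also have "(\<integral>\<^sup>+ s. ennreal (q / 2 * norm w * \<gamma> s) \<partial>lebesgue_on {0..t}) = ennreal (q / 2 * norm w * integral {0..t} \<gamma>)"
    using \<gamma>(1) q by (subst nn_integral_lebesgue_on_Icc) (auto simp: \<gamma>0 intro!: set_integrable_mult_right)
  also have "\<dots> \<le> ennreal (q / 2 * norm w * exp (V t))"
    using \<gamma>(2) q by (intro ennreal_leI mult_left_mono) auto
  also have "ennreal (sqrt (e w * c t)) + ennreal (q / 2 * norm w * exp (V t))
      = ennreal (sqrt (e w * c t) + q / 2 * exp (V t) * norm w)"
    using q e(2) c by (subst ennreal_plus) (auto simp: mult_ac)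
  finally have "ennreal \<bar>w \<bullet> x t\<bar> \<le> ennreal (sqrt (e w * c t) + q / 2 * exp (V t) * norm w)"
    by (simp add: add_left_mono add_right_mono)
  then show ?thesis
    using q e(2)[of w] c[of t] by (subst (asm) ennreal_le_iff) auto
qed

text \<open>
On a bounded time interval the trajectory is bounded, which is the error term of the first step; by
\<open>sqrt_energy_bound_improve\<close> it can be halved arbitrarily often.
\<close>

lemma trajectory_le_energy:
  fixes S :: "('n::finite, 'm::finite, 'p::finite) bqo"
  assumes u: "L2_input u" and traj: "bqo_trajectory S u x"
    and fin: "\<And>w. total_energy S w < \<infinity>" and T: "0 \<le> T"
  shows "ennreal ((w \<bullet> x T)\<^sup>2)
    \<le> ennreal (exp (L2_norm_sq (input0 S u)) * L2_norm_sq u) * total_energy S w"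
proof -
  define e where "e w = enn2real (total_energy S w)" for w
  have e: "total_energy S w = ennreal (e w)" "0 \<le> e w" for w
    using fin[of w] by (auto simp: e_def)
  define c where "c s = L2_norm_sq u * exp (integral {0..s} (\<lambda>r. (norm (input0 S u r))\<^sup>2))" for s
  have c: "0 \<le> c s" for s by (simp add: c_def L2_norm_sq_nonneg)
  obtain K1 where K1: "K1 > 0" "\<And>t w. t \<in> {0..T} \<Longrightarrow> norm (adjoint_flow (sysA S) w t) \<le> K1 * norm w"
    using adjoint_flow_bounded[of T "sysA S"] by blast
  \<comment> \<open>The summand 1 keeps \<open>K\<close> positive when all \<open>N\<^sub>k\<close> vanish.\<close>
  define K where "K = 1 + (\<Sum>k\<in>UNIV. onorm ((*v) (transpose (sysN S k)))) * K1"
  have on: "0 \<le> onorm ((*v) (transpose (sysN S k)))" for k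
    by (intro onorm_pos_le matrix_vector_mul_bounded_linear)
  have K: "K > 0" unfolding K_def using K1(1) on by (intro add_pos_nonneg mult_nonneg_nonneg sum_nonneg) auto
  have K': "L2_set (\<lambda>k. norm (transpose (sysN S k) *v adjoint_flow (sysA S) w \<tau>)) UNIV \<le> K * norm w"
    if "\<tau> \<in> {0..T}" for \<tau> w
  proof -
    have "L2_set (\<lambda>k. norm (transpose (sysN S k) *v adjoint_flow (sysA S) w \<tau>)) UNIV
        \<le> (\<Sum>k\<in>UNIV. norm (transpose (sysN S k) *v adjoint_flow (sysA S) w \<tau>))"
      by (rule L2_set_le_sum) simp
    also have "\<dots> \<le> (\<Sum>k\<in>UNIV. onorm ((*v) (transpose (sysN S k))) * (K1 * norm w))"
    proof (rule sum_mono)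
      fix k
      have "norm (transpose (sysN S k) *v adjoint_flow (sysA S) w \<tau>)
          \<le> onorm ((*v) (transpose (sysN S k))) * norm (adjoint_flow (sysA S) w \<tau>)"
        by (rule onorm[OF matrix_vector_mul_bounded_linear])
      also have "\<dots> \<le> onorm ((*v) (transpose (sysN S k))) * (K1 * norm w)"
        using K1(2)[OF that] on by (intro mult_left_mono) auto
      finally show "norm (transpose (sysN S k) *v adjoint_flow (sysA S) w \<tau>)
          \<le> onorm ((*v) (transpose (sysN S k))) * (K1 * norm w)" .
    qed
    also have "\<dots> \<le> K * norm w"
      by (simp add: K_def sum_distrib_left sum_distrib_right algebra_simps)
    finally show ?thesis .
  qed
  define V where "V s = integral {0..s} (\<lambda>r. 2 * K * norm (input0 S u r))" for s
  have V: "0 \<le> V s" for s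
    unfolding V_def
  proof (rule Henstock_Kurzweil_Integration.integral_nonneg)
    show "(\<lambda>r. 2 * K * norm (input0 S u r)) integrable_on {0..s}"
      using L2_input_on_Icc(3)[OF L2_input_input0[OF u]]
      by (intro integrable_on_mult_right) (auto simp: absolutely_integrable_on_def)
  qed (use K in auto)
  have "bounded (x ` {0..T})"
  proof (intro compact_imp_bounded compact_continuous_image)
    have "(\<lambda>s. bqo_rhs S (u s) (x s)) integrable_on {0..T}"
      using traj T by (auto simp: bqo_trajectory_def absolutely_integrable_on_def)
    from indefinite_integral_continuous_1[OF this]
    show "continuous_on {0..T} x"
      by (rule continuous_on_eq) (use traj in \<open>simp add: bqo_trajectory_def\<close>)
  qed auto
  then obtain X where X: "X > 0" "\<And>s. s \<in> {0..T} \<Longrightarrow> norm (x s) \<le> X"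
    unfolding bounded_pos by auto
  have iter: "\<forall>s\<in>{0..T}. \<forall>w. \<bar>w \<bullet> x s\<bar> \<le> sqrt (e w * c s) + X / 2 ^ n * exp (V s) * norm w" for n
  proof (induction n)
    case 0
    show ?case
    proof (intro ballI allI)
      fix s w assume s: "s \<in> {0..T}"
      have "\<bar>w \<bullet> x s\<bar> \<le> norm w * X"
        using X(2)[OF s] by (intro order_trans[OF Cauchy_Schwarz_ineq2] mult_left_mono) auto
      also have "\<dots> \<le> norm w * (X * exp (V s))"
        using X(1) V[of s] by (intro mult_left_mono) (auto simp: mult_le_cancel_left1)
      finally show "\<bar>w \<bullet> x s\<bar> \<le> sqrt (e w * c s) + X / 2 ^ 0 * exp (V s) * norm w"
        using e(2)[of w] c[of s] by (simp add: mult_ac add_increasing)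
    qed
  next
    case (Suc n)
    show ?case
    proof (intro ballI allI)
      fix s w assume s: "s \<in> {0..T}"
      have "\<bar>w \<bullet> x s\<bar> \<le> sqrt (e w * (L2_norm_sq u * exp (integral {0..s} (\<lambda>r. (norm (input0 S u r))\<^sup>2))))
          + X / 2 ^ n / 2 * exp (integral {0..s} (\<lambda>r. 2 * K * norm (input0 S u r))) * norm w"
      proof (rule sqrt_energy_bound_improve[OF u traj e _ K])
        show "\<bar>w \<bullet> x r\<bar> \<le> sqrt (e w * (L2_norm_sq u * exp (integral {0..r} (\<lambda>r. (norm (input0 S u r))\<^sup>2))))
          + X / 2 ^ n * exp (integral {0..r} (\<lambda>r. 2 * K * norm (input0 S u r))) * norm w"
          if "r \<in> {0..s}" for r w
        proof -
          have "r \<in> {0..T}" using that s by auto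
          then show ?thesis using Suc.IH unfolding c_def V_def by blast
        qed
        show "L2_set (\<lambda>k. norm (transpose (sysN S k) *v adjoint_flow (sysA S) w \<tau>)) UNIV \<le> K * norm w"
          if "\<tau> \<in> {0..s}" for \<tau> w
          using that s by (intro K') simp
      qed (use s X(1) in simp_all)
      then show "\<bar>w \<bullet> x s\<bar> \<le> sqrt (e w * c s) + X / 2 ^ Suc n * exp (V s) * norm w"
        by (simp add: c_def V_def)
    qed
  qed
  have lim: "(\<lambda>n. sqrt (e w * c T) + X * exp (V T) * norm w * (1 / 2) ^ n)
      \<longlonglongrightarrow> sqrt (e w * c T) + X * exp (V T) * norm w * 0"
    by (intro tendsto_intros LIMSEQ_power_zero) simp
  have "\<bar>w \<bullet> x T\<bar> \<le> sqrt (e w * c T) + X * exp (V T) * norm w * (1 / 2) ^ n" for n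
  proof -
    have "\<bar>w \<bullet> x T\<bar> \<le> sqrt (e w * c T) + X / 2 ^ n * exp (V T) * norm w"
      using iter[of n] T by simp
    then show ?thesis by (simp add: power_one_over)
  qed
  then have "\<bar>w \<bullet> x T\<bar> \<le> sqrt (e w * c T) + X * exp (V T) * norm w * 0"
    by (intro LIMSEQ_le_const[OF lim]) blast
  then have "\<bar>w \<bullet> x T\<bar> \<le> sqrt (e w * c T)" by simp
  then have "(w \<bullet> x T)\<^sup>2 \<le> e w * c T"
    using power_mono[of "\<bar>w \<bullet> x T\<bar>" "sqrt (e w * c T)" 2] e(2)[of w] c[of T] by simp
  also have "\<dots> \<le> e w * (exp (L2_norm_sq (input0 S u)) * L2_norm_sq u)"
  proof (intro mult_left_mono e(2))
    have "c T \<le> L2_norm_sq u * exp (L2_norm_sq (input0 S u))"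
      unfolding c_def using L2_input_on_Icc(2)[OF L2_input_input0[OF u]]
      by (intro mult_left_mono L2_norm_sq_nonneg) simp
    then show "c T \<le> exp (L2_norm_sq (input0 S u)) * L2_norm_sq u" by (simp only: mult.commute)
  qed
  finally show ?thesis
    unfolding e(1) using L2_norm_sq_nonneg[of u] e(2)[of w]
    by (subst ennreal_mult[symmetric]) (auto intro!: ennreal_leI simp: mult_ac)
qed

section \<open>The output bound for one system\<close>

definition linear_output_energy :: "('n::finite, 'm::finite, 'p::finite) bqo \<Rightarrow> ennreal" where
  "linear_output_energy S = (\<Sum>a\<in>UNIV. total_energy S (sysC S $ a))"

text \<open>
The part of the squared \<open>H\<^sub>2\<close> norm that comes from the matrices \<open>M\<^sub>j\<close>, after the second of the two
kernels has been summed and integrated into \<open>total_energy\<close>.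
\<close>

definition quadratic_output_energy :: "('n::finite, 'm::finite, 'p::finite) bqo \<Rightarrow> ennreal" where
  "quadratic_output_energy S = (\<Sum>i. \<integral>\<^sup>+ t \<in> nonneg_orthant (Suc i).
     (\<Sum>ks\<in>col_indices (Suc i). \<Sum>a\<in>UNIV. total_energy S (sysM S a *v Pbar S t ks)) \<partial>time_measure (Suc i))"

lemma nn_integral_sum_squares:
  assumes "finite J"
  shows "(\<integral>\<^sup>+ t \<in> nonneg_orthant i. ennreal (\<Sum>ks\<in>col_indices i. \<Sum>c\<in>J. (v c \<bullet> Pbar S t ks)\<^sup>2) \<partial>time_measure i)
    = (\<Sum>c\<in>J. kernel_energy S i (v c))"
proof -
  have "ennreal (\<Sum>ks\<in>col_indices i. \<Sum>c\<in>J. (v c \<bullet> Pbar S t ks)\<^sup>2)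
      = (\<Sum>c\<in>J. ennreal (\<Sum>ks\<in>col_indices i. (v c \<bullet> Pbar S t ks)\<^sup>2))" for t
    by (subst sum.swap, rule sum_ennreal[symmetric]) (simp add: sum_nonneg)
  then show ?thesis
    unfolding kernel_energy_def by (simp only: sum_distrib_right) (rule nn_integral_sum, measurable)
qed

lemma sum_total_energy: "(\<Sum>c\<in>J. total_energy S (v c)) = (\<Sum>i. \<Sum>c\<in>J. kernel_energy S (Suc i) (v c))"
  unfolding total_energy_def by (rule suminf_sum[symmetric]) (rule summableI)

lemma M_vec_kron_nth: "(M_vec S *v (v \<otimes>\<^sub>v w)) $ a = (sysM S a *v v) \<bullet> w"
proof -
  have "(M_vec S *v (v \<otimes>\<^sub>v w)) $ a = (\<Sum>p\<in>UNIV. \<Sum>q\<in>UNIV. sysM S a $ q $ p * (v $ p * w $ q))"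
    unfolding sum.cartesian_product UNIV_Times_UNIV
    by (simp add: matrix_vector_mult_def M_vec_def vec_of_def kron_vec_def case_prod_beta)
  also have "\<dots> = (\<Sum>q\<in>UNIV. \<Sum>p\<in>UNIV. sysM S a $ q $ p * (v $ p * w $ q))"
    by (rule sum.swap)
  also have "\<dots> = (sysM S a *v v) \<bullet> w"
    by (simp add: inner_vec_def matrix_vector_mult_def sum_distrib_left sum_distrib_right mult_ac)
  finally show ?thesis .
qed

lemma measurable_total_energy_Pbar:
  "(\<lambda>t. \<Sum>ks\<in>col_indices i. \<Sum>a\<in>UNIV. total_energy S (sysM S a *v Pbar S t ks)) \<in> borel_measurable (time_measure i)"
  by (intro borel_measurable_sum measurable_compose[OF _ measurable_total_energy]
      measurable_matrix_vector_mult measurable_Pbar) (auto simp: col_indices_def)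

lemma measurable_kernel_energy_Pbar:
  "(\<lambda>t. \<Sum>ks\<in>col_indices i. \<Sum>a\<in>UNIV. kernel_energy S j (sysM S a *v Pbar S t ks)) \<in> borel_measurable (time_measure i)"
  by (intro borel_measurable_sum measurable_compose[OF _ measurable_kernel_energy]
      measurable_matrix_vector_mult measurable_Pbar) (auto simp: col_indices_def)

lemma H2_norm_sq_eq: "H2_norm_sq S = linear_output_energy S + quadratic_output_energy S"
proof -
  have "(\<integral>\<^sup>+ t \<in> nonneg_orthant i. ennreal (frobenius_sq (col_indices i) (h_C S t)) \<partial>time_measure i)
      = (\<Sum>a\<in>UNIV. kernel_energy S i (sysC S $ a))" for i
    unfolding frobenius_sq_def h_C_def matrix_vector_mul_component
    by (rule nn_integral_sum_squares) simp
  then have 1: "(\<Sum>i. \<integral>\<^sup>+ t \<in> nonneg_orthant (Suc i).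
      ennreal (frobenius_sq (col_indices (Suc i)) (h_C S t)) \<partial>time_measure (Suc i)) = linear_output_energy S"
    unfolding linear_output_energy_def sum_total_energy by simp
  have inner: "(\<integral>\<^sup>+ t' \<in> nonneg_orthant j. ennreal (frobenius_sq (col_indices i \<times> col_indices j) (h_M S t t'))
      \<partial>time_measure j) = (\<Sum>ks\<in>col_indices i. \<Sum>a\<in>UNIV. kernel_energy S j (sysM S a *v Pbar S t ks))" for i j t
  proof -
    have "frobenius_sq (col_indices i \<times> col_indices j) (h_M S t t') =
        (\<Sum>ls\<in>col_indices j. \<Sum>c\<in>col_indices i \<times> UNIV. ((sysM S (snd c) *v Pbar S t (fst c)) \<bullet> Pbar S t' ls)\<^sup>2)" for t'
    proof -
      have "frobenius_sq (col_indices i \<times> col_indices j) (h_M S t t') =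
        (\<Sum>ks\<in>col_indices i. \<Sum>ls\<in>col_indices j. \<Sum>a\<in>UNIV. ((sysM S a *v Pbar S t ks) \<bullet> Pbar S t' ls)\<^sup>2)"
        unfolding frobenius_sq_def h_M_def M_vec_kron_nth by (simp add: sum.cartesian_product')
      also have "\<dots> = (\<Sum>ls\<in>col_indices j. \<Sum>ks\<in>col_indices i. \<Sum>a\<in>UNIV. ((sysM S a *v Pbar S t ks) \<bullet> Pbar S t' ls)\<^sup>2)"
        by (rule sum.swap)
      finally show ?thesis
        unfolding sum.cartesian_product by (simp add: case_prod_beta)
    qed
    then have "(\<integral>\<^sup>+ t' \<in> nonneg_orthant j. ennreal (frobenius_sq (col_indices i \<times> col_indices j) (h_M S t t'))
      \<partial>time_measure j) = (\<Sum>c\<in>col_indices i \<times> UNIV. kernel_energy S j (sysM S (snd c) *v Pbar S t (fst c)))"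
      by (simp only: nn_integral_sum_squares finite_cartesian_product finite_col_indices finite)
    then show ?thesis
      unfolding sum.cartesian_product by (simp add: case_prod_beta)
  qed
  have "(\<Sum>j. \<integral>\<^sup>+ t \<in> nonneg_orthant i. (\<Sum>ks\<in>col_indices i. \<Sum>a\<in>UNIV. kernel_energy S (Suc j) (sysM S a *v Pbar S t ks)) \<partial>time_measure i)
      = (\<integral>\<^sup>+ t \<in> nonneg_orthant i. (\<Sum>ks\<in>col_indices i. \<Sum>a\<in>UNIV. total_energy S (sysM S a *v Pbar S t ks)) \<partial>time_measure i)" for i
  proof -
    have *: "(\<Sum>ks\<in>col_indices i. \<Sum>a\<in>UNIV. total_energy S (sysM S a *v Pbar S t ks)) =
       (\<Sum>j. \<Sum>ks\<in>col_indices i. \<Sum>a\<in>UNIV. kernel_energy S (Suc j) (sysM S a *v Pbar S t ks))" for t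
      unfolding sum_total_energy by (rule suminf_sum[symmetric]) (rule summableI)
    have m: "(\<lambda>t. (\<Sum>ks\<in>col_indices i. \<Sum>a\<in>UNIV. kernel_energy S (Suc j) (sysM S a *v Pbar S t ks)) *
        indicator (nonneg_orthant i) t) \<in> borel_measurable (time_measure i)" for j
      by (intro borel_measurable_times_ennreal measurable_kernel_energy_Pbar borel_measurable_indicator
          nonneg_orthant_measurable)
    show ?thesis
      unfolding * ennreal_suminf_multc[symmetric] by (rule nn_integral_suminf[OF m, symmetric])
  qed
  then have 2: "(\<Sum>i. \<Sum>j. \<integral>\<^sup>+ t \<in> nonneg_orthant (Suc i). (\<integral>\<^sup>+ t' \<in> nonneg_orthant (Suc j).
        ennreal (frobenius_sq (col_indices (Suc i) \<times> col_indices (Suc j)) (h_M S t t'))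
        \<partial>time_measure (Suc j)) \<partial>time_measure (Suc i)) = quadratic_output_energy S"
    unfolding inner quadratic_output_energy_def by simp
  show ?thesis unfolding H2_norm_sq_def 1 2 ..
qed

lemma linear_output_le:
  assumes dom: "\<And>w. ennreal ((w \<bullet> v)\<^sup>2) \<le> ennreal c * total_energy S w"
  shows "ennreal ((norm (sysC S *v v))\<^sup>2) \<le> ennreal c * linear_output_energy S"
proof -
  have "(norm (sysC S *v v))\<^sup>2 = (\<Sum>a\<in>UNIV. (sysC S $ a \<bullet> v)\<^sup>2)"
    unfolding norm_vec_def L2_set_def matrix_vector_mul_component by (simp add: sum_nonneg)
  then have "ennreal ((norm (sysC S *v v))\<^sup>2) = (\<Sum>a\<in>UNIV. ennreal ((sysC S $ a \<bullet> v)\<^sup>2))"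
    by (simp add: sum_ennreal)
  also have "\<dots> \<le> (\<Sum>a\<in>UNIV. ennreal c * total_energy S (sysC S $ a))"
    by (intro sum_mono dom)
  finally show ?thesis by (simp add: linear_output_energy_def sum_distrib_left)
qed

text \<open>
The domination hypothesis is used twice: with \<open>w = M\<^sub>a v\<close>, and under the integral that defines the
energy at \<open>M\<^sub>a v\<close> with \<open>w = M\<^sub>a P\<close>, where the symmetry of \<open>M\<^sub>a\<close> exchanges \<open>v\<close> and the kernel column
\<open>P\<close>.
\<close>

lemma quadratic_output_le:
  assumes sym: "bqo_system S"
    and dom: "\<And>w. ennreal ((w \<bullet> v)\<^sup>2) \<le> ennreal c * total_energy S w" and c: "0 \<le> c"
  shows "ennreal ((norm (\<chi> a. v \<bullet> (sysM S a *v v)))\<^sup>2) \<le> ennreal (c\<^sup>2) * quadratic_output_energy S"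
proof -
  have flip: "(sysM S a *v v) \<bullet> z = (sysM S a *v z) \<bullet> v" for a z
    using sym by (metis bqo_system_def symmetric_matrix_def inner_transpose inner_commute)
  have int: "(\<Sum>a\<in>UNIV. kernel_energy S i (sysM S a *v v)) \<le> ennreal c * (\<integral>\<^sup>+ t \<in> nonneg_orthant i.
     (\<Sum>ks\<in>col_indices i. \<Sum>a\<in>UNIV. total_energy S (sysM S a *v Pbar S t ks)) \<partial>time_measure i)" for i
  proof -
    have "(\<Sum>a\<in>UNIV. kernel_energy S i (sysM S a *v v)) = (\<integral>\<^sup>+ t \<in> nonneg_orthant i.
        ennreal (\<Sum>ks\<in>col_indices i. \<Sum>a\<in>UNIV. ((sysM S a *v v) \<bullet> Pbar S t ks)\<^sup>2) \<partial>time_measure i)"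
      by (rule nn_integral_sum_squares[symmetric]) simp
    also have "\<dots> \<le> (\<integral>\<^sup>+ t. ennreal c * ((\<Sum>ks\<in>col_indices i. \<Sum>a\<in>UNIV. total_energy S (sysM S a *v Pbar S t ks))
        * indicator (nonneg_orthant i) t) \<partial>time_measure i)"
    proof (intro nn_integral_mono)
      fix t
      have "ennreal (\<Sum>ks\<in>col_indices i. \<Sum>a\<in>UNIV. ((sysM S a *v v) \<bullet> Pbar S t ks)\<^sup>2)
          = (\<Sum>ks\<in>col_indices i. \<Sum>a\<in>UNIV. ennreal (((sysM S a *v v) \<bullet> Pbar S t ks)\<^sup>2))"
        by (simp add: sum_ennreal sum_nonneg)
      also have "\<dots> \<le> (\<Sum>ks\<in>col_indices i. \<Sum>a\<in>UNIV. ennreal c * total_energy S (sysM S a *v Pbar S t ks))"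
        unfolding flip by (intro sum_mono dom)
      also have "\<dots> = ennreal c * (\<Sum>ks\<in>col_indices i. \<Sum>a\<in>UNIV. total_energy S (sysM S a *v Pbar S t ks))"
        by (simp add: sum_distrib_left)
      finally show "ennreal (\<Sum>ks\<in>col_indices i. \<Sum>a\<in>UNIV. ((sysM S a *v v) \<bullet> Pbar S t ks)\<^sup>2) * indicator (nonneg_orthant i) t
        \<le> ennreal c * ((\<Sum>ks\<in>col_indices i. \<Sum>a\<in>UNIV. total_energy S (sysM S a *v Pbar S t ks)) * indicator (nonneg_orthant i) t)"
        unfolding mult.assoc[symmetric] by (rule mult_right_mono) simp
    qed
    also have "\<dots> = ennreal c * (\<integral>\<^sup>+ t \<in> nonneg_orthant i.
      (\<Sum>ks\<in>col_indices i. \<Sum>a\<in>UNIV. total_energy S (sysM S a *v Pbar S t ks)) \<partial>time_measure i)"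
      by (intro nn_integral_cmult borel_measurable_times_ennreal measurable_total_energy_Pbar
          borel_measurable_indicator nonneg_orthant_measurable)
    finally show ?thesis .
  qed
  have "(norm (\<chi> a. v \<bullet> (sysM S a *v v)))\<^sup>2 = (\<Sum>a\<in>UNIV. ((sysM S a *v v) \<bullet> v)\<^sup>2)"
    unfolding norm_vec_def L2_set_def by (simp add: sum_nonneg inner_commute)
  then have "ennreal ((norm (\<chi> a. v \<bullet> (sysM S a *v v)))\<^sup>2) = (\<Sum>a\<in>UNIV. ennreal (((sysM S a *v v) \<bullet> v)\<^sup>2))"
    by (simp add: sum_ennreal)
  also have "\<dots> \<le> (\<Sum>a\<in>UNIV. ennreal c * total_energy S (sysM S a *v v))"
    by (intro sum_mono dom)
  also have "\<dots> = ennreal c * (\<Sum>i. \<Sum>a\<in>UNIV. kernel_energy S (Suc i) (sysM S a *v v))"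
    by (simp add: sum_total_energy[symmetric] sum_distrib_left)
  also have "\<dots> \<le> ennreal c * (\<Sum>i. ennreal c * (\<integral>\<^sup>+ t \<in> nonneg_orthant (Suc i).
     (\<Sum>ks\<in>col_indices (Suc i). \<Sum>a\<in>UNIV. total_energy S (sysM S a *v Pbar S t ks)) \<partial>time_measure (Suc i)))"
    by (intro mult_left_mono suminf_le int summableI) auto
  also have "\<dots> = ennreal (c\<^sup>2) * quadratic_output_energy S"
    using c by (simp add: quadratic_output_energy_def ennreal_suminf_cmult power2_eq_square ennreal_mult mult.assoc)
  finally show ?thesis .
qed

text \<open>
By the quadratic bound the integrand is at most \<open>\<kappa>\<close> times the sum of \<open>(r \<bullet> P)\<^sup>2\<close> over the finitely
many rows \<open>r\<close> of the matrices \<open>M\<^sub>a\<close>, so the integrals are energies again.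
\<close>

lemma quadratic_output_energy_finite:
  assumes \<kappa>: "\<And>w. total_energy S w \<le> ennreal (\<kappa> * (norm w)\<^sup>2)" and "0 \<le> \<kappa>"
  shows "quadratic_output_energy S < \<infinity>"
proof -
  define J where "J = (UNIV :: ('c \<times> 'a) set)"
  define r where "r c = sysM S (fst c) $ snd c" for c
  have "quadratic_output_energy S \<le> (\<Sum>i. ennreal \<kappa> * (\<Sum>c\<in>J. kernel_energy S (Suc i) (r c)))"
    unfolding quadratic_output_energy_def
  proof (intro suminf_le summableI)
    fix i
    have "(\<integral>\<^sup>+ t \<in> nonneg_orthant (Suc i).
        (\<Sum>ks\<in>col_indices (Suc i). \<Sum>a\<in>UNIV. total_energy S (sysM S a *v Pbar S t ks)) \<partial>time_measure (Suc i))
      \<le> (\<integral>\<^sup>+ t. ennreal \<kappa> * (ennreal (\<Sum>ks\<in>col_indices (Suc i). \<Sum>c\<in>J. (r c \<bullet> Pbar S t ks)\<^sup>2) *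
          indicator (nonneg_orthant (Suc i)) t) \<partial>time_measure (Suc i))"
    proof (intro nn_integral_mono)
      fix t
      have rows: "(\<Sum>a\<in>UNIV. (norm (sysM S a *v Pbar S t ks))\<^sup>2) = (\<Sum>c\<in>J. (r c \<bullet> Pbar S t ks)\<^sup>2)" for ks
      proof -
        have "(norm (sysM S a *v Pbar S t ks))\<^sup>2 = (\<Sum>b\<in>UNIV. (sysM S a $ b \<bullet> Pbar S t ks)\<^sup>2)" for a
          unfolding norm_vec_def L2_set_def matrix_vector_mul_component by (simp add: sum_nonneg)
        then show ?thesis
          unfolding J_def UNIV_Times_UNIV[symmetric] r_def by (simp add: sum.cartesian_product case_prod_beta)
      qed
      have "(\<Sum>ks\<in>col_indices (Suc i). \<Sum>a\<in>UNIV. total_energy S (sysM S a *v Pbar S t ks))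
        \<le> (\<Sum>ks\<in>col_indices (Suc i). \<Sum>a\<in>UNIV. ennreal (\<kappa> * (norm (sysM S a *v Pbar S t ks))\<^sup>2))"
        by (intro sum_mono \<kappa>)
      also have "\<dots> = ennreal (\<kappa> * (\<Sum>ks\<in>col_indices (Suc i). \<Sum>c\<in>J. (r c \<bullet> Pbar S t ks)\<^sup>2))"
        unfolding rows[symmetric] using \<open>0 \<le> \<kappa>\<close> by (simp add: sum_ennreal sum_nonneg sum_distrib_left)
      finally show "(\<Sum>ks\<in>col_indices (Suc i). \<Sum>a\<in>UNIV. total_energy S (sysM S a *v Pbar S t ks)) *
          indicator (nonneg_orthant (Suc i)) t
        \<le> ennreal \<kappa> * (ennreal (\<Sum>ks\<in>col_indices (Suc i). \<Sum>c\<in>J. (r c \<bullet> Pbar S t ks)\<^sup>2) *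
          indicator (nonneg_orthant (Suc i)) t)"
        unfolding mult.assoc[symmetric] using \<open>0 \<le> \<kappa>\<close>
        by (intro mult_right_mono) (simp_all add: ennreal_mult sum_nonneg)
    qed
    also have "\<dots> = ennreal \<kappa> * (\<integral>\<^sup>+ t \<in> nonneg_orthant (Suc i).
        ennreal (\<Sum>ks\<in>col_indices (Suc i). \<Sum>c\<in>J. (r c \<bullet> Pbar S t ks)\<^sup>2) \<partial>time_measure (Suc i))"
    proof (intro nn_integral_cmult borel_measurable_times_ennreal borel_measurable_indicator nonneg_orthant_measurable)
      have "(\<lambda>t. \<Sum>ks\<in>col_indices (Suc i). \<Sum>c\<in>J. (r c \<bullet> Pbar S t ks)\<^sup>2) \<in> borel_measurable (time_measure (Suc i))"
        by (intro borel_measurable_sum borel_measurable_power borel_measurable_inner measurable_Pbar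
            borel_measurable_const) (auto simp: col_indices_def)
      then show "(\<lambda>t. ennreal (\<Sum>ks\<in>col_indices (Suc i). \<Sum>c\<in>J. (r c \<bullet> Pbar S t ks)\<^sup>2))
          \<in> borel_measurable (time_measure (Suc i))"
        by (rule measurable_compose[OF _ measurable_ennreal])
    qed
    also have "\<dots> = ennreal \<kappa> * (\<Sum>c\<in>J. kernel_energy S (Suc i) (r c))"
      by (subst nn_integral_sum_squares) (simp_all add: J_def)
    finally show "(\<integral>\<^sup>+ t \<in> nonneg_orthant (Suc i).
        (\<Sum>ks\<in>col_indices (Suc i). \<Sum>a\<in>UNIV. total_energy S (sysM S a *v Pbar S t ks)) \<partial>time_measure (Suc i))
      \<le> ennreal \<kappa> * (\<Sum>c\<in>J. kernel_energy S (Suc i) (r c))" .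
  qed
  also have "\<dots> = ennreal \<kappa> * (\<Sum>c\<in>J. total_energy S (r c))"
    by (simp add: ennreal_suminf_cmult sum_total_energy)
  also have "\<dots> \<le> ennreal \<kappa> * (\<Sum>c\<in>J. ennreal (\<kappa> * (norm (r c))\<^sup>2))"
    by (intro mult_left_mono sum_mono \<kappa>) simp
  also have "\<dots> < \<infinity>"
    using \<open>0 \<le> \<kappa>\<close> by (simp add: sum_ennreal ennreal_mult[symmetric] sum_nonneg)
  finally show ?thesis .
qed

lemma norm_kron_vec: "norm (v \<otimes>\<^sub>v w) = norm v * norm w"
proof -
  have "(norm (v \<otimes>\<^sub>v w))\<^sup>2 = (\<Sum>a\<in>UNIV. \<Sum>b\<in>UNIV. (v $ a * w $ b)\<^sup>2)"
    unfolding sum.cartesian_product UNIV_Times_UNIV norm_vec_def L2_set_def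
    by (simp add: kron_vec_def case_prod_beta sum_nonneg)
  also have "\<dots> = (norm v * norm w)\<^sup>2"
    unfolding power_mult_distrib norm_vec_def L2_set_def
    by (simp add: sum_nonneg sum_product power_mult_distrib)
  finally show ?thesis by (simp add: power2_eq_iff_nonneg)
qed

lemma L2_norm_sq_kron_eq: "L2_norm_sq_kron u = (L2_norm_sq u)\<^sup>2"
  unfolding L2_norm_sq_kron_def norm_kron_vec power_mult_distrib L2_norm_sq_def
  by (simp add: power2_eq_square)

text \<open>
With \<open>h\<^sub>C\<close> and \<open>h\<^sub>M\<close> the two parts of the squared \<open>H\<^sub>2\<close> norm, the linear output has norm at most
\<open>sqrt (h\<^sub>C c)\<close> and the quadratic output at most \<open>sqrt (h\<^sub>M c\<^sup>2)\<close>; by the Cauchy-Schwarz inequality the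
sum of the two is at most \<open>sqrt ((h\<^sub>C + h\<^sub>M) (c + c\<^sup>2))\<close>.
\<close>

lemma output_le_H2:
  fixes S :: "('n::finite, 'm::finite, 'p::finite) bqo"
  assumes sym: "bqo_system S" and u: "L2_input u" and traj: "bqo_trajectory S u x"
    and \<kappa>: "\<And>w. total_energy S w \<le> ennreal (\<kappa> * (norm w)\<^sup>2)" "0 \<le> \<kappa>" and t: "0 \<le> t"
  shows "H2_norm_sq S < \<infinity>"
    and "ennreal ((norm (bqo_output S x t))\<^sup>2) \<le> H2_norm_sq S *
        ennreal (exp (L2_norm_sq (input0 S u)) * L2_norm_sq u
               + exp (2 * L2_norm_sq (input0 S u)) * L2_norm_sq_kron u)"
proof -
  have fin: "total_energy S w < \<infinity>" for w
    using \<kappa>(1)[of w] by (rule le_less_trans) simp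
  have C: "linear_output_energy S < \<infinity>"
    using fin by (simp add: linear_output_energy_def)
  have M: "quadratic_output_energy S < \<infinity>"
    by (rule quadratic_output_energy_finite[OF \<kappa>])
  show "H2_norm_sq S < \<infinity>" using C M by (simp add: H2_norm_sq_eq)
  define c where "c = exp (L2_norm_sq (input0 S u)) * L2_norm_sq u"
  have c: "0 \<le> c" by (simp add: c_def L2_norm_sq_nonneg)
  have dom: "ennreal ((w \<bullet> x t)\<^sup>2) \<le> ennreal c * total_energy S w" for w
    unfolding c_def by (rule trajectory_le_energy[OF u traj fin t])
  obtain hC where hC: "linear_output_energy S = ennreal hC" "0 \<le> hC"
    using C by (cases "linear_output_energy S") auto
  obtain hM where hM: "quadratic_output_energy S = ennreal hM" "0 \<le> hM"
    using M by (cases "quadratic_output_energy S") auto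
  define a where "a = sysC S *v x t"
  define b where "b = (\<chi> j. x t \<bullet> (sysM S j *v x t))"
  have "ennreal ((norm a)\<^sup>2) \<le> ennreal (c * hC)"
    using linear_output_le[OF dom] by (simp add: a_def hC ennreal_mult c)
  then have "(norm a)\<^sup>2 \<le> c * hC"
    using c hC(2) by (subst (asm) ennreal_le_iff) auto
  then have na: "norm a \<le> sqrt hC * sqrt c"
    by (intro real_le_rsqrt[of "norm a" "hC * c", unfolded real_sqrt_mult]) (simp add: mult.commute)
  have "ennreal ((norm b)\<^sup>2) \<le> ennreal (c\<^sup>2 * hM)"
    using quadratic_output_le[OF sym dom c] by (simp add: b_def hM ennreal_mult)
  then have "(norm b)\<^sup>2 \<le> c\<^sup>2 * hM"
    using hM(2) by (subst (asm) ennreal_le_iff) auto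
  then have nb: "norm b \<le> sqrt hM * c"
    using real_le_rsqrt[of "norm b" "hM * c\<^sup>2"] c by (simp add: mult.commute real_sqrt_mult)
  have "norm (a + b) \<le> sqrt hC * sqrt c + sqrt hM * c"
    using norm_triangle_ineq[of a b] na nb by simp
  also have "\<dots> \<le> sqrt (hC + hM) * sqrt (c + c\<^sup>2)"
    using two_term_Cauchy_Schwarz[of "sqrt hC" "sqrt c" "sqrt hM" c] hC(2) hM(2) c by simp
  finally have "(norm (a + b))\<^sup>2 \<le> (sqrt (hC + hM) * sqrt (c + c\<^sup>2))\<^sup>2"
    by (rule power_mono) simp
  also have "\<dots> = (hC + hM) * (c + c\<^sup>2)"
    using hC(2) hM(2) c by (simp add: power_mult_distrib)
  finally have "ennreal ((norm (bqo_output S x t))\<^sup>2) \<le> ennreal ((hC + hM) * (c + c\<^sup>2))"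
    by (intro ennreal_leI) (simp add: bqo_output_def a_def b_def)
  also have "\<dots> = H2_norm_sq S * ennreal (c + c\<^sup>2)"
    using hC(2) hM(2) c by (simp add: H2_norm_sq_eq hC(1) hM(1) ennreal_mult ennreal_plus[symmetric] del: ennreal_plus)
  also have "c\<^sup>2 = exp (2 * L2_norm_sq (input0 S u)) * L2_norm_sq_kron u"
    by (simp add: c_def L2_norm_sq_kron_eq power_mult_distrib exp_double)
  finally show "ennreal ((norm (bqo_output S x t))\<^sup>2) \<le> H2_norm_sq S *
        ennreal (exp (L2_norm_sq (input0 S u)) * L2_norm_sq u
               + exp (2 * L2_norm_sq (input0 S u)) * L2_norm_sq_kron u)"
    by (simp add: c_def)
qed

section \<open>The error system\<close>

definition join_vec :: "real ^ 'n \<Rightarrow> real ^ 'r \<Rightarrow> real ^ ('n + 'r)" where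
  "join_vec v v' = (\<chi> i. case i of Inl a \<Rightarrow> v $ a | Inr a \<Rightarrow> v' $ a)"

lemma join_vec_nth [simp]: "join_vec v v' $ Inl a = v $ a" "join_vec v v' $ Inr b = v' $ b"
  by (simp_all add: join_vec_def)

lemma vec_eq_iff_sum: "v = w \<longleftrightarrow> (\<forall>a. v $ Inl a = w $ Inl a) \<and> (\<forall>b. v $ Inr b = w $ Inr b)"
  for v w :: "'x ^ ('n::finite + 'r::finite)"
  unfolding vec_eq_iff by (metis sum.exhaust)

lemma join_vec_cases:
  obtains v v' where "w = join_vec v v'"
  by (rule that[of "\<chi> a. w $ Inl a" "\<chi> b. w $ Inr b"]) (simp add: vec_eq_iff_sum)

lemma sum_UNIV_sum: "(\<Sum>i\<in>UNIV. f i) = (\<Sum>a\<in>UNIV. f (Inl a)) + (\<Sum>b\<in>UNIV. f (Inr b))"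
  for f :: "'n::finite + 'r::finite \<Rightarrow> 'a::comm_monoid_add"
  using sum.Plus[of UNIV UNIV f] by (simp add: UNIV_Plus_UNIV o_def)

lemma inner_join_vec [simp]: "join_vec v v' \<bullet> join_vec w w' = v \<bullet> w + v' \<bullet> w'"
  by (simp add: inner_vec_def sum_UNIV_sum)

lemma join_vec_add: "join_vec v v' + join_vec w w' = join_vec (v + w) (v' + w')"
  by (simp add: vec_eq_iff_sum)

lemma join_vec_scaleR: "c *\<^sub>R join_vec v v' = join_vec (c *\<^sub>R v) (c *\<^sub>R v')"
  by (simp add: vec_eq_iff_sum)

lemma join_vec_sum: "(\<Sum>k\<in>K. join_vec (v k) (v' k)) = join_vec (\<Sum>k\<in>K. v k) (\<Sum>k\<in>K. v' k)"
  by (simp add: vec_eq_iff_sum)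

lemma block_diag_mult [simp]: "block_diag Q R *v join_vec v v' = join_vec (Q *v v) (R *v v')"
  by (simp add: vec_eq_iff_sum matrix_vector_mult_def block_diag_def sum_UNIV_sum)

lemma transpose_block_diag [simp]: "transpose (block_diag Q R) = block_diag (transpose Q) (transpose R)"
  unfolding vec_eq_iff_sum by (simp add: vec_eq_iff_sum transpose_def block_diag_def)

lemma stack_rows_mult [simp]: "stack_rows Q R *v w = join_vec (Q *v w) (R *v w)"
  by (simp add: vec_eq_iff_sum matrix_vector_mult_def stack_rows_def)

lemma transpose_stack_rows_mult [simp]:
  "transpose (stack_rows Q R) *v join_vec v v' = transpose Q *v v + transpose R *v v'"
  unfolding vec_eq_iff by (simp add: matrix_vector_mult_def stack_rows_def sum_UNIV_sum transpose_def)

lemma append_cols_mult [simp]: "append_cols Q R *v join_vec v v' = Q *v v + R *v v'"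
  by (simp add: vec_eq_iff matrix_vector_mult_def append_cols_def sum_UNIV_sum)

lemma minus_matrix_vector_mult: "(- Q) *v v = - (Q *v v)" for Q :: "real ^ 'n ^ 'm"
  by (simp add: vec_eq_iff matrix_vector_mult_def sum_negf)

lemma symmetric_matrix_block_diag:
  "symmetric_matrix Q \<Longrightarrow> symmetric_matrix R \<Longrightarrow> symmetric_matrix (block_diag Q R)"
  by (simp add: symmetric_matrix_def)

lemma symmetric_matrix_minus: "symmetric_matrix Q \<Longrightarrow> symmetric_matrix (- Q)"
  by (simp add: symmetric_matrix_def transpose_def vec_eq_iff)

lemma symmetric_matrix_scaleR: "symmetric_matrix Q \<Longrightarrow> symmetric_matrix (c *\<^sub>R Q)"
  by (simp add: symmetric_matrix_def transpose_def vec_eq_iff)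

lemma bqo_system_error_system:
  assumes "bqo_system S" "bqo_system S'"
  shows "bqo_system (error_system S S')"
  using assms
  by (simp add: bqo_system_def error_system_def symmetric_matrix_block_diag symmetric_matrix_minus)

lemma bqo_rhs_error_system:
  "bqo_rhs (error_system S S') w (join_vec z z') = join_vec (bqo_rhs S w z) (bqo_rhs S' w z')"
  by (simp add: bqo_rhs_def error_system_def join_vec_add join_vec_scaleR join_vec_sum)

lemma bqo_output_error_system:
  "bqo_output (error_system S S') (\<lambda>s. join_vec (x s) (x' s)) t = bqo_output S x t - bqo_output S' x' t"
  by (simp add: bqo_output_def error_system_def minus_matrix_vector_mult vec_eq_iff)

lemma bqo_trajectory_error_system:
  assumes x: "bqo_trajectory S u x" and x': "bqo_trajectory S' u x'"
  shows "bqo_trajectory (error_system S S') u (\<lambda>s. join_vec (x s) (x' s))"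
  unfolding bqo_trajectory_def bqo_rhs_error_system
proof (intro conjI allI impI)
  show "join_vec (x 0) (x' 0) = 0"
    using x x' by (simp add: bqo_trajectory_def vec_eq_iff_sum)
  fix t :: real assume "0 \<le> t"
  define f where "f s = bqo_rhs S (u s) (x s)" for s
  define f' where "f' s = bqo_rhs S' (u s) (x' s)" for s
  have f: "f absolutely_integrable_on {0..t}" "x t = integral {0..t} f"
    and f': "f' absolutely_integrable_on {0..t}" "x' t = integral {0..t} f'"
    using x x' \<open>0 \<le> t\<close> by (auto simp: bqo_trajectory_def f_def[abs_def] f'_def[abs_def])
  have "(\<lambda>s. join_vec (f s) (f' s) $ i) absolutely_integrable_on {0..t}" for i
    using f(1) f'(1) by (cases i) (simp_all add: absolutely_integrable_on_iff_component)
  then show int: "(\<lambda>s. join_vec (bqo_rhs S (u s) (x s)) (bqo_rhs S' (u s) (x' s))) absolutely_integrable_on {0..t}"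
    by (simp add: absolutely_integrable_on_iff_component f_def f'_def)
  have "integral {0..t} (\<lambda>s. join_vec (f s) (f' s)) $ i = join_vec (integral {0..t} f) (integral {0..t} f') $ i" for i
  proof -
    have "(\<lambda>s. join_vec (f s) (f' s)) integrable_on {0..t}" "f integrable_on {0..t}" "f' integrable_on {0..t}"
      using int f(1) f'(1) by (simp_all add: absolutely_integrable_on_def f_def f'_def)
    then show ?thesis
      by (cases i) (simp_all flip: integral_component_eq_cart)
  qed
  then show "join_vec (x t) (x' t) = integral {0..t} (\<lambda>s. join_vec (bqo_rhs S (u s) (x s)) (bqo_rhs S' (u s) (x' s)))"
    unfolding vec_eq_iff by (simp add: f(2) f'(2) f_def f'_def)
qed

text \<open>
The generalized Lyapunov equation, tested with \<open>w\<close> on both sides.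
\<close>

lemma gen_sylvester_quadratic_form:
  assumes P: "symmetric_matrix P" and eq: "gen_sylvester S S P"
  shows "2 * ((transpose (sysA S) *v w) \<bullet> (P *v w)) +
       (\<Sum>k\<in>UNIV. (transpose (sysN S k) *v w) \<bullet> (P *v (transpose (sysN S k) *v w))) +
       (norm (transpose (sysB S) *v w))\<^sup>2 = 0"
proof -
  have sum_mult: "(\<Sum>k\<in>K. Q k) *v w = (\<Sum>k\<in>K. Q k *v w)" for K and Q :: "'b \<Rightarrow> real ^ 'a ^ 'a"
    by (induction K rule: infinite_finite_induct) (simp_all add: matrix_vector_mult_add_rdistrib)
  have "(sysA S ** P + P ** transpose (sysA S) + (\<Sum>k\<in>UNIV. sysN S k ** P ** transpose (sysN S k)) +
      sysB S ** transpose (sysB S)) *v w = 0"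
    using eq unfolding gen_sylvester_def by (simp only: matrix_vector_mult_0)
  then have "w \<bullet> (sysA S ** P *v w + P ** transpose (sysA S) *v w +
      (\<Sum>k\<in>UNIV. sysN S k ** P ** transpose (sysN S k) *v w) + sysB S ** transpose (sysB S) *v w) = 0"
    unfolding matrix_vector_mult_add_rdistrib sum_mult by (simp only: inner_zero_right)
  moreover have "w \<bullet> (sysA S ** P *v w) = (transpose (sysA S) *v w) \<bullet> (P *v w)"
    by (simp only: matrix_vector_mul_assoc[symmetric] inner_transpose[of w "sysA S"])
  moreover have "w \<bullet> (P ** transpose (sysA S) *v w) = (transpose (sysA S) *v w) \<bullet> (P *v w)"
  proof -
    have "w \<bullet> (P *v (transpose (sysA S) *v w)) = (P *v w) \<bullet> (transpose (sysA S) *v w)"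
      using P unfolding inner_transpose[of w P] symmetric_matrix_def by simp
    then show ?thesis by (simp only: matrix_vector_mul_assoc[symmetric] inner_commute)
  qed
  moreover have "w \<bullet> (sysN S k ** P ** transpose (sysN S k) *v w)
      = (transpose (sysN S k) *v w) \<bullet> (P *v (transpose (sysN S k) *v w))" for k
    by (simp only: matrix_vector_mul_assoc[symmetric] inner_transpose[of w "sysN S k"])
  moreover have "w \<bullet> (sysB S ** transpose (sysB S) *v w) = (norm (transpose (sysB S) *v w))\<^sup>2"
    by (simp only: matrix_vector_mul_assoc[symmetric] inner_transpose[of w "sysB S"] power2_norm_eq_inner)
  ultimately show ?thesis
    by (simp only: inner_add_right inner_sum_right)
qed

text \<open>
The block diagonal matrix with blocks \<open>2 P\<close> and \<open>2 P'\<close> satisfies the Lyapunov inequality of the error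
system. The two equations contribute \<open>- 2 |b|\<^sup>2 - 2 |b'|\<^sup>2\<close> with \<open>b = B\<^sup>T v\<close> and \<open>b' = B'\<^sup>T v'\<close>, while the
stacked input matrix contributes \<open>|b + b'|\<^sup>2\<close>; the factor 2 absorbs the mixed term.
\<close>

lemma total_energy_error_system_le:
  assumes P: "sym_pos_semidef P" "gen_sylvester S S P"
    and P': "sym_pos_semidef P'" "gen_sylvester S' S' P'"
  obtains \<kappa> where "0 \<le> \<kappa>" "\<And>w. total_energy (error_system S S') w \<le> ennreal (\<kappa> * (norm w)\<^sup>2)"
proof -
  define G where "G = block_diag (2 *\<^sub>R P) (2 *\<^sub>R P')"
  have G: "sym_pos_semidef G"
  proof -
    have "0 \<le> w \<bullet> (G *v w)" for w
      using P(1) P'(1) by (cases w rule: join_vec_cases) (simp add: G_def scaleR_matrix_vector_assoc[symmetric] sym_pos_semidef_def)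
    moreover have "symmetric_matrix G"
      using P(1) P'(1) unfolding G_def sym_pos_semidef_def
      by (intro symmetric_matrix_block_diag symmetric_matrix_scaleR) auto
    ultimately show ?thesis by (simp add: sym_pos_semidef_def)
  qed
  have "total_energy (error_system S S') w \<le> ennreal (w \<bullet> (G *v w))" for w
  proof (rule total_energy_le[OF G])
    fix w :: "real ^ ('a + 'd)"
    obtain v v' where w: "w = join_vec v v'" by (rule join_vec_cases)
    define b where "b = transpose (sysB S) *v v"
    define b' where "b' = transpose (sysB S') *v v'"
    have "(norm (b + b'))\<^sup>2 + (norm (b - b'))\<^sup>2 = 2 * (norm b)\<^sup>2 + 2 * (norm b')\<^sup>2"
      by (simp add: power2_norm_eq_inner inner_simps inner_commute)
    then have "(norm (b + b'))\<^sup>2 \<le> 2 * (norm b)\<^sup>2 + 2 * (norm b')\<^sup>2"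
      by (metis add_le_cancel_left le_add_same_cancel1 zero_le_power2)
    moreover note gen_sylvester_quadratic_form[OF _ P(2), of v] gen_sylvester_quadratic_form[OF _ P'(2), of v']
    ultimately show "2 * ((transpose (sysA (error_system S S')) *v w) \<bullet> (G *v w)) +
       (\<Sum>k\<in>UNIV. (transpose (sysN (error_system S S') k) *v w) \<bullet> (G *v (transpose (sysN (error_system S S') k) *v w))) +
       (norm (transpose (sysB (error_system S S')) *v w))\<^sup>2 \<le> 0"
      using P(1) P'(1) unfolding w
      by (simp del: transpose_matrix_vector add: G_def error_system_def scaleR_matrix_vector_assoc[symmetric]
          sym_pos_semidef_def b_def b'_def sum.distrib sum_distrib_left[symmetric])
  qed
  moreover have "w \<bullet> (G *v w) \<le> onorm ((*v) G) * (norm w)\<^sup>2" for w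
  proof -
    have "w \<bullet> (G *v w) \<le> norm w * norm (G *v w)" by (rule norm_cauchy_schwarz)
    also have "\<dots> \<le> norm w * (onorm ((*v) G) * norm w)"
      by (intro mult_left_mono onorm matrix_vector_mul_bounded_linear) simp
    finally show ?thesis by (simp add: power2_eq_square mult_ac)
  qed
  ultimately have "total_energy (error_system S S') w \<le> ennreal (onorm ((*v) G) * (norm w)\<^sup>2)" for w
    by (meson ennreal_leI order_trans)
  then show ?thesis
    using that onorm_pos_le[OF matrix_vector_mul_bounded_linear[of G]] by blast
qed

theorem corollary4p8:
  fixes S :: "('n::finite, 'm::finite, 'p::finite) bqo"
    and S' :: "('r::finite, 'm, 'p) bqo"
    and P :: "real ^ 'n ^ 'n" and P' :: "real ^ 'r ^ 'r" and X :: "real ^ 'r ^ 'n"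
    and u :: "real \<Rightarrow> real ^ 'm"
    and x :: "real \<Rightarrow> real ^ 'n" and x' :: "real \<Rightarrow> real ^ 'r"
  assumes "bqo_system S" and "bqo_system S'"
    and "stable_matrix (sysA S)" and "stable_matrix (sysA S')"
    and "gen_sylvester S S P" and "\<forall>Q. gen_sylvester S S Q \<longrightarrow> Q = P"
    and "gen_sylvester S' S' P'" and "\<forall>Q. gen_sylvester S' S' Q \<longrightarrow> Q = P'"
    and "gen_sylvester S S' X" and "\<forall>Q. gen_sylvester S S' Q \<longrightarrow> Q = X"
    and "sym_pos_semidef P" and "sym_pos_semidef P'"
    and "L2_input u"
    and "bqo_trajectory S u x" and "bqo_trajectory S' u x'"
  shows "H2_norm_sq (error_system S S') < \<infinity> \<and>
    (SUP t\<in>{0..}. ennreal ((norm (bqo_output S x t - bqo_output S' x' t))\<^sup>2))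
      \<le> H2_norm_sq (error_system S S') *
        ennreal (exp (L2_norm_sq (input0 (error_system S S') u)) * L2_norm_sq u
               + exp (2 * L2_norm_sq (input0 (error_system S S') u)) * L2_norm_sq_kron u)"
proof -
  obtain \<kappa> where \<kappa>: "0 \<le> \<kappa>" "\<And>w. total_energy (error_system S S') w \<le> ennreal (\<kappa> * (norm w)\<^sup>2)"
    using total_energy_error_system_le assms(5,7,11,12) by blast
  note bound = output_le_H2[OF bqo_system_error_system[OF assms(1,2)] assms(13)
      bqo_trajectory_error_system[OF assms(14,15)] \<kappa>(2,1)]
  show ?thesis
    using bound(1)[of 0] bound(2) by (auto simp: bqo_output_error_system intro!: SUP_least)
qed

end
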